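(* For every integer $n>3\binom{31}{4}$, the maximum number of copies of $C_4$ in an $n$-vertex graph containing no copy of $C_6$ is \[ \mathrm{ex}(n,C_4,C_6)=\binom{n-2}{2}+2, \] and equality holds only for the graph obtained from $K_{2,n-2}$ by adding a single edge inside each of its two parts (one edge inside the part of size $2$ and one edge inside the part of size $n-2$).
   Context: $C_k$ denotes the cycle on $k$ vertices and $K_{a,b}$ the complete bipartite graph with parts of sizes $a$ and $b$. A copy of $H$ in $G$ is a (not necessarily induced) subgraph of $G$ isomorphic to $H$; $G$ is $F$-free if it contains no copy of $F$. $\mathrm{ex}(n,H,F)$ denotes the maximum number of copies of $H$ over all $n$-vertex $F$-free graphs. *)

theory Defs
  imports Complex_Main
begin

text \<open>A graph is a pair of a vertex set and a set of edges, an edge being a two-element vertex set.\<close>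

type_synonym 'a sgraph = "'a set \<times> 'a set set"

abbreviation verts :: "'a sgraph \<Rightarrow> 'a set" where
  "verts \<equiv> fst"

abbreviation edges :: "'a sgraph \<Rightarrow> 'a set set" where
  "edges \<equiv> snd"

definition simple_graph :: "'a sgraph \<Rightarrow> bool" where
  "simple_graph G \<longleftrightarrow> finite (verts G) \<and> (\<forall>e\<in>edges G. e \<subseteq> verts G \<and> card e = 2)"

definition subgraph :: "'a sgraph \<Rightarrow> 'a sgraph \<Rightarrow> bool" where
  "subgraph S G \<longleftrightarrow> simple_graph S \<and> verts S \<subseteq> verts G \<and> edges S \<subseteq> edges G"

definition isomorphic :: "'a sgraph \<Rightarrow> 'b sgraph \<Rightarrow> bool" where
  "isomorphic G H \<longleftrightarrow>
     (\<exists>f. bij_betw f (verts G) (verts H) \<and> (\<lambda>e. f ` e) ` edges G = edges H)"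

definition copies :: "'b sgraph \<Rightarrow> 'a sgraph \<Rightarrow> 'a sgraph set" where
  "copies H G = {S. subgraph S G \<and> isomorphic S H}"

definition free_of :: "'b sgraph \<Rightarrow> 'a sgraph \<Rightarrow> bool" where
  "free_of F G \<longleftrightarrow> copies F G = {}"

text \<open>The number of copies is invariant under isomorphism, so it suffices to let the maximum range
  over the finitely many graphs with vertex set \<open>{..<n}\<close>. If \<open>F\<close> has an edge, the edgeless graph
  shows that the maximum is over a nonempty set.\<close>

definition ex_num :: "nat \<Rightarrow> 'b sgraph \<Rightarrow> 'c sgraph \<Rightarrow> nat" where
  "ex_num n H F =
     Max {card (copies H G) | G :: nat sgraph.
            simple_graph G \<and> verts G = {..<n} \<and> free_of F G}"

text \<open>This is the cycle on \<open>k\<close> vertices only for \<open>k \<ge> 3\<close>.\<close>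

definition cycle_graph :: "nat \<Rightarrow> nat sgraph" where
  "cycle_graph k = ({..<k}, {{i, Suc i mod k} | i. i < k})"

definition complete_bipartite :: "nat \<Rightarrow> nat \<Rightarrow> (nat + nat) sgraph" where
  "complete_bipartite a b =
     (Inl ` {..<a} \<union> Inr ` {..<b}, {{Inl i, Inr j} | i j. i < a \<and> j < b})"

text \<open>All choices of the edge added inside the second part give isomorphic graphs. The definition
  is meant for \<open>n \<ge> 4\<close>.\<close>

definition extremal_graph :: "nat \<Rightarrow> (nat + nat) sgraph" where
  "extremal_graph n =
     (verts (complete_bipartite 2 (n - 2)),
      edges (complete_bipartite 2 (n - 2)) \<union> {{Inl 0, Inl 1}, {Inr 0, Inr 1}})"

end

theory Submission
  imports Defs
begin

text \<open>Call the number of common neighbours of two vertices their codegree. If two vertices \<open>a\<close>, \<open>b\<close> have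
  codegree at least 4, then any two of their common neighbours have no third common neighbour, as
  this would close a 6-cycle. Hence every 4-cycle has a diagonal of codegree at most 3, so there are at most
  \<open>3 (n choose 2)\<close> 4-cycles.

  Let \<open>{a, b}\<close> be a pair of maximal codegree \<open>m\<close>, \<open>N\<close> the set of common neighbours and \<open>R\<close> the set of the
  remaining vertices. If \<open>m \<le> 7\<close>, double counting gives far fewer than \<open>(n - 2) choose 2\<close> 4-cycles. Otherwise,
  there are only about \<open>(m choose 2) + (5/8) m |R|\<close> 4-cycles that meet \<open>N\<close>, while deleting \<open>N\<close> lowers
  \<open>(n - 2) choose 2\<close> by \<open>(m choose 2) + m |R|\<close>. So deleting \<open>N\<close> (if \<open>R\<close> is large) or one vertex of \<open>R\<close> (if
  \<open>R\<close> is small but nonempty) increases the excess of the number of 4-cycles over \<open>(n - 2) choose 2\<close> by at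
  least the number of deleted vertices, and if \<open>R\<close> is empty, the graph either has no excess or is
  extremal. A non-extremal graph with excess at least 2 on more than \<open>3 (31 choose 4)\<close> vertices would
  therefore lead to a graph on at most 250 vertices that violates the bound
  \<open>3 (n choose 2)\<close>.\<close>

section \<open>Copies of cycles\<close>

text \<open>A 4-cycle is a $K_{2,2}$ and is encoded by its two diagonals \<open>A\<close> and
  \<open>B\<close>, the pairs of opposite vertices. In a simple graph, adjacency of all of
  \<open>A\<close> to all of \<open>B\<close> makes the diagonals disjoint.\<close>

definition C4_of :: "'a set \<Rightarrow> 'a set \<Rightarrow> 'a sgraph" where
  "C4_of A B = (A \<union> B, {{a, b} | a b. a \<in> A \<and> b \<in> B})"

definition C4s :: "'a sgraph \<Rightarrow> 'a sgraph set" where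
  "C4s G = {C4_of A B | A B. card A = 2 \<and> card B = 2 \<and> (\<forall>a\<in>A. \<forall>b\<in>B. {a, b} \<in> edges G)}"

lemma C4_of_commute: "C4_of A B = C4_of B A"
  unfolding C4_of_def by (auto simp: insert_commute)

text \<open>Inverting the isomorphism turns a copy into an injective cyclic enumeration
  \<open>g\<close> of its vertices. In this form the copies for \<open>k = 4\<close> and
  \<open>k = 6\<close> can be written out vertex by vertex.\<close>

lemma copies_cycle_graph:
  assumes "simple_graph G"
  shows "copies (cycle_graph k) G =
    {S. \<exists>g. inj_on g {..<k} \<and> g ` {..<k} \<subseteq> verts G \<and> (\<forall>i<k. {g i, g (Suc i mod k)} \<in> edges G) \<and>
        S = (g ` {..<k}, {{g i, g (Suc i mod k)} | i. i < k})}"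
    (is "?L = ?R")
proof (intro equalityI subsetI)
  fix S assume S: "S \<in> ?L"
  then obtain f where f: "bij_betw f (verts S) {..<k}"
      and fe: "(\<lambda>e. f ` e) ` edges S = {{i, Suc i mod k} | i. i < k}"
      and sub: "subgraph S G"
    by (auto simp: copies_def isomorphic_def cycle_graph_def)
  define g where "g = inv_into (verts S) f"
  have g: "bij_betw g {..<k} (verts S)" unfolding g_def by (rule bij_betw_inv_into[OF f])
  have gf: "g ` f ` e = e" if "e \<in> edges S" for e
  proof -
    have "e \<subseteq> verts S" using sub that by (auto simp: subgraph_def simple_graph_def)
    then show ?thesis unfolding g_def
      using f by (simp add: bij_betw_def inv_into_image_cancel)
  qed
  have "edges S = (\<lambda>e. g ` e) ` (\<lambda>e. f ` e) ` edges S"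
    using gf by (force simp: image_image)
  also have "\<dots> = {{g i, g (Suc i mod k)} | i. i < k}"
    unfolding fe by (auto simp: image_iff) (metis image_empty image_insert)+
  finally have e: "edges S = {{g i, g (Suc i mod k)} | i. i < k}" .
  have v: "verts S = g ` {..<k}" using g by (simp add: bij_betw_def)
  have "S = (g ` {..<k}, {{g i, g (Suc i mod k)} | i. i < k})"
    using e v by (metis prod.collapse)
  moreover have "inj_on g {..<k}" "g ` {..<k} \<subseteq> verts G"
      "\<forall>i<k. {g i, g (Suc i mod k)} \<in> edges G"
    using g sub e v by (auto simp: subgraph_def bij_betw_def)
  ultimately show "S \<in> ?R" unfolding mem_Collect_eq by (intro exI conjI)
next
  fix S assume "S \<in> ?R"
  then obtain g where g: "inj_on g {..<k}" "g ` {..<k} \<subseteq> verts G"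
      "\<forall>i<k. {g i, g (Suc i mod k)} \<in> edges G"
      and S: "S = (g ` {..<k}, {{g i, g (Suc i mod k)} | i. i < k})"
    unfolding mem_Collect_eq by (elim exE conjE)
  have sub: "subgraph S G"
  proof -
    have "e \<subseteq> g ` {..<k} \<and> card e = 2" if "e \<in> {{g i, g (Suc i mod k)} | i. i < k}" for e
    proof -
      from that obtain i where i: "i < k" "e = {g i, g (Suc i mod k)}" by blast
      then have "e \<in> edges G" using g by simp
      then have "card e = 2" using assms by (simp add: simple_graph_def)
      moreover have "Suc i mod k < k" using i by simp
      ultimately show ?thesis using i by blast
    qed
    then have "simple_graph S" by (simp add: simple_graph_def S)
    moreover have "edges S \<subseteq> edges G" using g(3) unfolding S by auto
    ultimately show ?thesis using g(2) by (simp add: subgraph_def S)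
  qed
  define f where "f = inv_into {..<k} g"
  have f: "bij_betw f (verts S) {..<k}"
    unfolding f_def S fst_conv by (rule bij_betw_inv_into) (simp add: g(1) bij_betw_def)
  have fg: "f (g i) = i" if "i < k" for i using g that by (simp add: f_def)
  have "(\<lambda>e. f ` e) ` edges S = {{i, Suc i mod k} | i. i < k}"
  proof -
    have "f ` {g i, g (Suc i mod k)} = {i, Suc i mod k}" if "i < k" for i
      using fg[OF that] fg[of "Suc i mod k"] that by simp
    then have "(\<lambda>e. f ` e) ` (\<lambda>i. {g i, g (Suc i mod k)}) ` {..<k} = (\<lambda>i. {i, Suc i mod k}) ` {..<k}"
      unfolding image_image by (intro image_cong) auto
    then show ?thesis unfolding S snd_conv setcompr_eq_image lessThan_def .
  qed
  with f sub show "S \<in> ?L"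
    unfolding copies_def isomorphic_def cycle_graph_def by (simp, blast)
qed

lemma C4_of_pairs:
  "C4_of {a, a'} {b, b'} = ({a, a', b, b'}, {{a, b}, {a, b'}, {a', b}, {a', b'}})"
  unfolding C4_of_def by auto

lemma C4_of_cycle:
  "C4_of {a, c} {b, d} = ({a, b, c, d}, {{a, b}, {b, c}, {c, d}, {d, a}})"
proof -
  have "{c, b} = {b, c}" "{a, d} = {d, a}" by auto
  then show ?thesis unfolding C4_of_pairs by auto
qed

lemma lessThan_4: "{..<4::nat} = {0,1,2,3}" by auto
lemma lessThan_6: "{..<6::nat} = {0,1,2,3,4,5}" by auto
lemma all_less_4: "(\<forall>i<4::nat. P i) \<longleftrightarrow> P 0 \<and> P 1 \<and> P 2 \<and> P 3"
  using lessThan_4 by (metis insertE insertI1 insertI2 empty_iff lessThan_iff)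
lemma all_less_6: "(\<forall>i<6::nat. P i) \<longleftrightarrow> P 0 \<and> P 1 \<and> P 2 \<and> P 3 \<and> P 4 \<and> P 5"
  using lessThan_6 by (metis (no_types, lifting) insertE insertI1 insertI2 empty_iff lessThan_iff)

lemma Suc_mod_4: "Suc 0 mod 4 = 1" "Suc 1 mod 4 = 2" "Suc 2 mod 4 = 3" "Suc 3 mod 4 = 0"
  by simp_all

lemma Suc_mod_6: "Suc 0 mod 6 = 1" "Suc 1 mod 6 = 2" "Suc 2 mod 6 = 3" "Suc 3 mod 6 = 4"
  "Suc 4 mod 6 = 5" "Suc 5 mod 6 = 0"
  by simp_all

lemma cycle_edges_4:
  "{{g i, g (Suc i mod 4)} | i. i < (4::nat)} = {{g 0, g 1}, {g 1, g 2}, {g 2, g 3}, {g 3, g 0}}"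
proof -
  have "{{g i, g (Suc i mod 4)} | i. i < (4::nat)} = (\<lambda>i. {g i, g (Suc i mod 4)}) ` {..<4}"
    unfolding setcompr_eq_image lessThan_def ..
  then show ?thesis unfolding lessThan_4 by (simp only: image_insert image_empty Suc_mod_4)
qed

lemma copies_C4:
  assumes "simple_graph G"
  shows "copies (cycle_graph 4) G = C4s G"
proof (intro equalityI subsetI)
  fix S assume "S \<in> copies (cycle_graph 4) G"
  then obtain g :: "nat \<Rightarrow> 'a" where g: "inj_on g {..<4}"
      and ge: "\<forall>i<4. {g i, g (Suc i mod 4)} \<in> edges G"
      and S: "S = (g ` {..<4}, {{g i, g (Suc i mod 4)} | i. i < 4})"
    unfolding copies_cycle_graph[OF assms] by blast
  have S': "S = ({g 0, g 1, g 2, g 3}, {{g 0, g 1}, {g 1, g 2}, {g 2, g 3}, {g 3, g 0}})"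
    unfolding S cycle_edges_4 lessThan_4 by (simp only: image_insert image_empty)
  have e: "{g 0, g 1} \<in> edges G" "{g 1, g 2} \<in> edges G" "{g 2, g 3} \<in> edges G" "{g 3, g 0} \<in> edges G"
    using ge unfolding all_less_4 Suc_mod_4 by simp_all
  have "S = C4_of {g 0, g 2} {g 1, g 3}"
    unfolding S' C4_of_cycle ..
  moreover have "card {g 0, g 2} = 2" "card {g 1, g 3} = 2"
    using g by (simp_all add: lessThan_4)
  moreover have "\<forall>a\<in>{g 0, g 2}. \<forall>b\<in>{g 1, g 3}. {a, b} \<in> edges G"
    using e insert_commute[of "g 2" "g 1" "{}"] insert_commute[of "g 0" "g 3" "{}"] by simp
  ultimately show "S \<in> C4s G" unfolding C4s_def by blast
next
  fix S assume "S \<in> C4s G"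
  then obtain A B where S: "S = C4_of A B" and c: "card A = 2" "card B = 2"
      and e: "\<forall>a\<in>A. \<forall>b\<in>B. {a, b} \<in> edges G" unfolding C4s_def by blast
  from c obtain a a' b b' where A: "A = {a, a'}" "a \<noteq> a'" and B: "B = {b, b'}" "b \<noteq> b'"
    by (auto simp: card_2_iff)
  have irr: "{u, u} \<notin> edges G" for u using assms by (auto simp: simple_graph_def)
  have d: "a \<noteq> b" "a \<noteq> b'" "a' \<noteq> b" "a' \<noteq> b'" using e irr A B by auto
  have vs: "{a, a', b, b'} \<subseteq> verts G" using e assms A B by (auto simp: simple_graph_def)
  define g where "g = (\<lambda>i::nat. if i = 0 then a else if i = 1 then b else if i = 2 then a' else b')"
  have "inj_on g {..<4}" using A B d by (auto simp: lessThan_4 g_def)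
  moreover have "g ` {..<4} \<subseteq> verts G" using vs by (auto simp: lessThan_4 g_def)
  moreover have "\<forall>i<4. {g i, g (Suc i mod 4)} \<in> edges G"
    unfolding all_less_4 Suc_mod_4
    using e A B insert_commute[of b a' "{}"] insert_commute[of b' a "{}"] by (simp add: g_def)
  moreover have "S = (g ` {..<4}, {{g i, g (Suc i mod 4)} | i. i < 4})"
    unfolding S A B C4_of_cycle cycle_edges_4 lessThan_4 image_insert image_empty by (simp add: g_def)
  ultimately show "S \<in> copies (cycle_graph 4) G"
    unfolding copies_cycle_graph[OF assms] by blast
qed

lemma free_of_C6:
  assumes "simple_graph G"
  shows "free_of (cycle_graph 6) G \<longleftrightarrow>
    (\<forall>a b c d e f. distinct [a, b, c, d, e, f] \<longrightarrow> {a, b} \<in> edges G \<longrightarrow> {b, c} \<in> edges G \<longrightarrow>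
       {c, d} \<in> edges G \<longrightarrow> {d, e} \<in> edges G \<longrightarrow> {e, f} \<in> edges G \<longrightarrow> {f, a} \<notin> edges G)"
    (is "?L \<longleftrightarrow> ?R")
proof
  assume L: ?L
  show ?R
  proof (intro allI impI notI)
    fix a b c d e f
    assume ds: "distinct [a, b, c, d, e, f]" and E: "{a, b} \<in> edges G" "{b, c} \<in> edges G"
       "{c, d} \<in> edges G" "{d, e} \<in> edges G" "{e, f} \<in> edges G" "{f, a} \<in> edges G"
    define g where "g = (\<lambda>i::nat. [a, b, c, d, e, f] ! i)"
    have v: "g 0 = a" "g 1 = b" "g 2 = c" "g 3 = d" "g 4 = e" "g 5 = f"
      by (simp_all add: g_def numeral_eq_Suc)
    have "inj_on g {..<6}" unfolding lessThan_6 using ds v by auto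
    moreover have "g ` {..<6} \<subseteq> verts G"
      unfolding lessThan_6 using E assms v by (auto simp: simple_graph_def)
    moreover have "\<forall>i<6. {g i, g (Suc i mod 6)} \<in> edges G"
      unfolding all_less_6 Suc_mod_6 v using E by simp
    ultimately have "(g ` {..<6}, {{g i, g (Suc i mod 6)} | i. i < 6}) \<in> copies (cycle_graph 6) G"
      unfolding copies_cycle_graph[OF assms] by blast
    with L show False by (simp add: free_of_def)
  qed
next
  assume R: ?R
  show ?L
  proof (rule ccontr)
    assume "\<not> ?L"
    then have "copies (cycle_graph 6) G \<noteq> {}" by (simp add: free_of_def)
    then obtain g :: "nat \<Rightarrow> 'a" where g: "inj_on g {..<6}"
        and e: "\<forall>i<6. {g i, g (Suc i mod 6)} \<in> edges G"
      unfolding copies_cycle_graph[OF assms] by blast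
    have "distinct [g 0, g 1, g 2, g 3, g 4, g 5]" using g by (simp add: lessThan_6)
    moreover have "{g 0, g 1} \<in> edges G" "{g 1, g 2} \<in> edges G" "{g 2, g 3} \<in> edges G"
        "{g 3, g 4} \<in> edges G" "{g 4, g 5} \<in> edges G" "{g 5, g 0} \<in> edges G"
      using e unfolding all_less_6 Suc_mod_6 by simp_all
    ultimately show False using R by blast
  qed
qed

text \<open>The cross term \<open>m * r\<close> is the budget for the deletion of \<open>N\<close>,
  where \<open>m\<close> and \<open>r\<close> are the sizes of \<open>N\<close> and
  \<open>R\<close>.\<close>

lemma choose_two_add: "(m + r) choose 2 = (m choose 2) + (r choose 2) + m * (r::nat)"
  by (induction r) (simp_all add: numeral_2_eq_2)

lemma choose_two_double: "2 * (n choose 2) = n * (n - 1)"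
  unfolding choose_two by (rule dvd_mult_div_cancel) (cases n; simp)

text \<open>The extremal graph up to renaming: \<open>{a, b}\<close> is the small part with its
  inner edge, \<open>{x, y}\<close> the edge inside the large part. Named vertices in an arbitrary
  vertex set keep isomorphisms out of the counting.\<close>

definition K2_plus_edges :: "'a sgraph \<Rightarrow> 'a \<Rightarrow> 'a \<Rightarrow> 'a \<Rightarrow> 'a \<Rightarrow> bool" where
  "K2_plus_edges G a b x y \<longleftrightarrow>
     a \<noteq> b \<and> x \<noteq> y \<and> {a, b} \<subseteq> verts G \<and> {x, y} \<subseteq> verts G - {a, b} \<and>
     edges G = {{a, b}, {x, y}} \<union> {{c, z} | c z. c \<in> {a, b} \<and> z \<in> verts G - {a, b}}"

section \<open>Codegrees in graphs without 6-cycles\<close>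

locale C6_free_graph =
  fixes V :: "'a set" and E :: "'a set set"
  assumes finite_V: "finite V"
    and edge: "X \<in> E \<Longrightarrow> X \<subseteq> V \<and> card X = 2"
    and no_C6: "\<lbrakk>{a, b} \<in> E; {b, c} \<in> E; {c, d} \<in> E; {d, e} \<in> E; {e, f} \<in> E; {f, a} \<in> E\<rbrakk>
      \<Longrightarrow> \<not> distinct [a, b, c, d, e, f]"
begin

definition adj :: "'a \<Rightarrow> 'a \<Rightarrow> bool" where
  "adj u v \<longleftrightarrow> {u, v} \<in> E"

definition nb :: "'a \<Rightarrow> 'a set" where
  "nb v = {u. adj v u}"

abbreviation cn :: "'a \<Rightarrow> 'a \<Rightarrow> 'a set" where
  "cn u v \<equiv> nb u \<inter> nb v"

lemma adj_sym: "adj u v \<longleftrightarrow> adj v u"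
  by (simp add: adj_def insert_commute)

lemma adj_irrefl [simp]: "\<not> adj v v"
  using edge[of "{v, v}"] by (auto simp: adj_def)

lemma adj_V: "adj u v \<Longrightarrow> u \<in> V \<and> v \<in> V"
  using edge[of "{u, v}"] by (auto simp: adj_def)

lemma nb_V: "nb v \<subseteq> V"
  using adj_V by (auto simp: nb_def)

lemma finite_nb [simp]: "finite (nb v)"
  using nb_V finite_V by (rule finite_subset)

lemma nb_iff: "u \<in> nb v \<longleftrightarrow> adj v u"
  by (simp add: nb_def)

lemma no_hexagon:
  assumes "adj a b" "adj b c" "adj c d" "adj d e" "adj e f" "adj f a"
    and "distinct [a, b, c, d, e, f]"
  shows False
  using no_C6 assms unfolding adj_def by blast

lemma C4s_eq:
  "C4s (V, E) = {C4_of A B | A B. card A = 2 \<and> card B = 2 \<and> (\<forall>a\<in>A. \<forall>b\<in>B. adj a b)}"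
  by (simp add: C4s_def adj_def)

lemma C4_of_disjoint: "\<forall>a\<in>A. \<forall>b\<in>B. adj a b \<Longrightarrow> A \<inter> B = {}"
  by force

lemma finite_C4s: "finite (C4s (V, E))"
proof (rule finite_subset)
  show "C4s (V, E) \<subseteq> (\<lambda>(A, B). C4_of A B) ` (Pow V \<times> Pow V)"
  proof
    fix C assume "C \<in> C4s (V, E)"
    then obtain A B where C: "C = C4_of A B" "card A = 2" "card B = 2" "\<forall>a\<in>A. \<forall>b\<in>B. adj a b"
      unfolding C4s_eq by blast
    then have "A \<noteq> {}" "B \<noteq> {}" by auto
    then have "A \<subseteq> V" "B \<subseteq> V" using C(4) adj_V by blast+
    with C(1) show "C \<in> (\<lambda>(A, B). C4_of A B) ` (Pow V \<times> Pow V)" by auto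
  qed
qed (use finite_V in auto)

text \<open>A third common neighbour \<open>w\<close> of \<open>x\<close> and \<open>y\<close> would
  close the hexagon \<open>a x w y b z\<close>, where \<open>z\<close> is a common neighbour of
  \<open>a\<close> and \<open>b\<close> other than \<open>x\<close>, \<open>y\<close>,
  \<open>w\<close>.\<close>

lemma cn_of_fat:
  assumes fat: "card (cn a b) \<ge> 4" and ab: "a \<noteq> b"
    and x: "x \<in> cn a b" and y: "y \<in> cn a b" and "x \<noteq> y"
  shows "cn x y = {a, b}"
proof
  show "{a, b} \<subseteq> cn x y" using x y by (auto simp: nb_iff adj_sym)
  show "cn x y \<subseteq> {a, b}"
  proof (rule ccontr)
    assume "\<not> ?thesis"
    then obtain w where w: "w \<in> cn x y" "w \<noteq> a" "w \<noteq> b" by blast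
    have "\<not> cn a b \<subseteq> {x, y, w}"
      using card_mono[of "{x, y, w}" "cn a b"] card_insert_le_m1[of 3 "{y, w}" x] fat
      by (auto simp: card_insert_if split: if_splits)
    then obtain z where z: "z \<in> cn a b" "z \<noteq> x" "z \<noteq> y" "z \<noteq> w" by blast
    have "adj a x" "adj x w" "adj w y" "adj y b" "adj b z" "adj z a"
      using x y w z by (auto simp: nb_iff adj_sym)
    moreover have "distinct [a, x, w, y, b, z]"
      using x y w z ab \<open>x \<noteq> y\<close> by (auto simp: nb_iff)
    ultimately show False by (rule no_hexagon)
  qed
qed

text \<open>By \<open>cn_of_fat\<close> the two diagonals of a 4-cycle cannot both have codegree at
  least 4. So it lies in \<open>W A\<close>, the set of 4-cycles with diagonal \<open>A\<close>, for
  some pair \<open>A\<close> in \<open>D3\<close>, and such a pair leaves at most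
  \<open>3 choose 2\<close> choices for the other diagonal.\<close>

lemma C4_count_le: "card (C4s (V, E)) \<le> 3 * (card V choose 2)"
proof -
  define D where "D = {A. A \<subseteq> V \<and> card A = 2}"
  define W where "W A = {C4_of A B | B. card B = 2 \<and> (\<forall>a\<in>A. \<forall>b\<in>B. adj a b)}" for A
  define D3 where "D3 = {A\<in>D. card {w. \<forall>a\<in>A. adj a w} \<le> 3}"
  have cnA: "{w. \<forall>z\<in>{a, b}. adj z w} = cn a b" for a b by (auto simp: nb_iff)
  have W: "card (W A) \<le> 3" if A3: "A \<in> D3" for A
  proof -
    let ?N = "{w. \<forall>a\<in>A. adj a w}"
    obtain a b where "A = {a, b}" using A3 unfolding D3_def D_def card_2_iff by blast
    then have fin: "finite ?N" by (simp only: cnA) simp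
    have "W A \<subseteq> C4_of A ` {B. B \<subseteq> ?N \<and> card B = 2}" by (auto simp: W_def)
    then have "card (W A) \<le> card {B. B \<subseteq> ?N \<and> card B = 2}"
      using fin by (intro surj_card_le) auto
    also have "\<dots> = card ?N choose 2" using fin by (simp add: n_subsets)
    also have "\<dots> \<le> 3 choose 2" using that by (intro binomial_right_mono) (simp add: D3_def)
    also have "\<dots> = 3" by (simp add: choose_two)
    finally show ?thesis .
  qed
  have finD: "finite D" using finite_V by (simp add: D_def)
  have D: "A \<in> D" if "card A = 2" "card B = 2" "\<forall>a\<in>A. \<forall>b\<in>B. adj a b" for A B
  proof -
    have "B \<noteq> {}" using that by auto
    then show ?thesis using that adj_V by (auto simp: D_def)
  qed
  have sub: "C4s (V, E) \<subseteq> (\<Union>A\<in>D3. W A)"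
  proof
    fix C assume "C \<in> C4s (V, E)"
    then obtain A B where C: "C = C4_of A B" and c: "card A = 2" "card B = 2"
        and ad: "\<forall>a\<in>A. \<forall>b\<in>B. adj a b" unfolding C4s_eq by blast
    have ad': "\<forall>a\<in>B. \<forall>b\<in>A. adj a b" using ad adj_sym by blast
    have "A \<in> D3 \<or> B \<in> D3"
    proof (rule ccontr)
      assume no: "\<not> ?thesis"
      obtain a a' where A: "A = {a, a'}" "a \<noteq> a'" using c by (auto simp: card_2_iff)
      obtain b b' where B: "B = {b, b'}" "b \<noteq> b'" using c by (auto simp: card_2_iff)
      have "card (cn a a') \<ge> 4"
        using no D[OF c ad] cnA[of a a'] unfolding D3_def A by simp
      then have "cn b b' = {a, a'}"
        using cn_of_fat[of a a' b b'] A B ad by (auto simp: nb_iff)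
      then have "card (cn b b') \<le> 2" using A by simp
      then show False
        using no D[OF c(2,1) ad'] cnA[of b b'] unfolding D3_def B by simp
    qed
    moreover have "C \<in> W A" unfolding W_def using C c ad by blast
    moreover have "C \<in> W B" unfolding W_def C C4_of_commute[of A B] using c ad' by blast
    ultimately show "C \<in> (\<Union>A\<in>D3. W A)" by blast
  qed
  have finW: "finite (W A)" if "A \<in> D3" for A
  proof -
    have "W A \<subseteq> C4s (V, E)" using that unfolding W_def C4s_eq D3_def D_def by blast
    then show ?thesis using finite_C4s finite_subset by blast
  qed
  have fin3: "finite D3" using finD by (simp add: D3_def)
  have "card (C4s (V, E)) \<le> card (\<Union>A\<in>D3. W A)"
    using sub finW fin3 by (intro card_mono) auto
  also have "\<dots> \<le> (\<Sum>A\<in>D3. card (W A))" using fin3 by (rule card_UN_le)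
  also have "\<dots> \<le> card D3 * 3" using sum_bounded_above[of D3 "\<lambda>A. card (W A)" 3] W by simp
  also have "\<dots> \<le> card D * 3" using finD by (simp add: card_mono D3_def)
  also have "card D = card V choose 2" using finite_V by (simp add: D_def n_subsets)
  finally show ?thesis by simp
qed

section \<open>The 4-cycles through a vertex\<close>

text \<open>The elements of \<open>fans v L\<close> stand for the 4-cycles through \<open>v\<close> both of whose neighbours of \<open>v\<close> lie
  in \<open>L\<close>: the first component is the vertex opposite to \<open>v\<close>.\<close>

definition fans :: "'a \<Rightarrow> 'a set \<Rightarrow> ('a \<times> 'a set) set" where
  "fans v L = {(y, P). y \<noteq> v \<and> P \<subseteq> L \<and> card P = 2 \<and> P \<subseteq> nb y}"

text \<open>For \<open>q \<in> L\<close> and \<open>L \<subseteq> nb v\<close>, a corner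
  \<open>(y, p)\<close> stands for the 4-cycle \<open>v q y p\<close> through the edge
  \<open>v q\<close>. With \<open>v\<close> and \<open>q\<close> fixed, corners are treated as cells
  of a matrix with rows \<open>y\<close> and columns \<open>p\<close>.\<close>

definition corners :: "'a \<Rightarrow> 'a set \<Rightarrow> 'a \<Rightarrow> ('a \<times> 'a) set" where
  "corners v L q = {(y, p). y \<noteq> v \<and> p \<in> L \<and> p \<noteq> q \<and> adj y q \<and> adj y p}"

text \<open>Otherwise \<open>v p y q y' p'\<close> would be a hexagon.\<close>

lemma corners_cross:
  assumes L: "L \<subseteq> nb v" "q \<in> L" and "(y, p) \<in> corners v L q" "(y', p') \<in> corners v L q" "y \<noteq> y'"
  shows "p = p' \<or> p = y' \<or> p' = y"
proof (rule ccontr)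
  assume no: "\<not> ?thesis"
  have "adj v p" "adj p y" "adj y q" "adj q y'" "adj y' p'" "adj p' v"
    using assms by (auto simp: corners_def nb_iff adj_sym)
  moreover have "distinct [v, p, y, q, y', p']"
    using assms no by (auto simp: corners_def nb_iff)
  ultimately show False by (rule no_hexagon)
qed

section \<open>Rows and columns of corners\<close>

definition row :: "'a \<Rightarrow> 'a set \<Rightarrow> 'a \<Rightarrow> 'a \<Rightarrow> 'a set" where
  "row v L q y = {p. (y, p) \<in> corners v L q}"

definition col :: "'a \<Rightarrow> 'a set \<Rightarrow> 'a \<Rightarrow> 'a \<Rightarrow> 'a set" where
  "col v L q p = {y. (y, p) \<in> corners v L q}"

text \<open>Rows and columns are indexed by the same vertices, so \<open>y\<close> can head a long
  row and a long column at once. This is the exceptional shape, for which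
  \<open>card_corners_le\<close> gives only the weaker bound \<open>2 * s\<close>.\<close>

definition special :: "'a \<Rightarrow> 'a set \<Rightarrow> 'a \<Rightarrow> 'a \<Rightarrow> bool" where
  "special v L q y \<longleftrightarrow> q \<in> L \<and> 3 \<le> card (row v L q y) \<and> 3 \<le> card (col v L q y)"

lemma finite_corners:
  assumes "L \<subseteq> nb v" shows "finite (corners v L q)"
proof (rule finite_subset)
  show "corners v L q \<subseteq> V \<times> L" using adj_V by (auto simp: corners_def)
  show "finite (V \<times> L)" using assms finite_V finite_subset[OF assms] by simp
qed

lemma finite_row: "L \<subseteq> nb v \<Longrightarrow> finite (row v L q y)"
  by (rule finite_subset[of _ "nb v"]) (auto simp: row_def corners_def)

lemma finite_col: "finite (col v L q p)"
  by (rule finite_subset[of _ "nb q"]) (auto simp: col_def corners_def nb_iff adj_sym)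

lemma row_eq: "p \<in> row v L q y \<Longrightarrow> row v L q y = L \<inter> nb y - {q}"
  by (auto simp: row_def corners_def nb_iff)

lemma three_elements:
  assumes "3 \<le> card S" obtains x where "x \<in> S" "x \<noteq> a" "x \<noteq> b"
proof -
  have "card {a, b} \<le> 2" by (simp add: card_insert_if)
  then have "\<not> S \<subseteq> {a, b}" using card_mono[of "{a, b}" S] assms by auto
  then show ?thesis using that by blast
qed

text \<open>A cell outside row \<open>y\<close> and column \<open>y\<close> would contradict
  \<open>corners_cross\<close> when compared with an entry of the row that differs from both its
  coordinates; three entries leave such a choice.\<close>

lemma row_fat:
  assumes "L \<subseteq> nb v" "q \<in> L" "3 \<le> card (row v L q y)"
  shows "corners v L q \<subseteq> {y} \<times> row v L q y \<union> col v L q y \<times> {y}"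
proof clarify
  fix y' p' assume c: "(y', p') \<in> corners v L q" and "\<not> (y' \<in> col v L q y \<and> p' \<in> {y})"
  then have "p' \<noteq> y" by (auto simp: col_def)
  obtain p where p: "p \<in> row v L q y" "p \<noteq> p'" "p \<noteq> y'" using three_elements[OF assms(3)] .
  have "y' = y"
    using corners_cross[OF assms(1,2), of y p y' p'] p c \<open>p' \<noteq> y\<close> by (auto simp: row_def)
  then show "y' \<in> {y} \<and> p' \<in> row v L q y" using c by (simp add: row_def)
qed

lemma col_fat:
  assumes "L \<subseteq> nb v" "q \<in> L" "3 \<le> card (col v L q p)"
  shows "corners v L q \<subseteq> col v L q p \<times> {p} \<union> {p} \<times> row v L q p"
proof clarify
  fix y' p' assume c: "(y', p') \<in> corners v L q" and "\<not> (y' \<in> {p} \<and> p' \<in> row v L q p)"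
  then have "y' \<noteq> p" by (auto simp: row_def)
  obtain y where y: "y \<in> col v L q p" "y \<noteq> y'" "y \<noteq> p'" using three_elements[OF assms(3)] .
  have "p' = p"
    using corners_cross[OF assms(1,2), of y p y' p'] y c \<open>y' \<noteq> p\<close> by (auto simp: col_def)
  then show "y' \<in> col v L q p \<and> p' \<in> {p}" using c by (simp add: col_def)
qed

text \<open>A corner \<open>(z, y)\<close> at \<open>q\<close> is also a corner
  \<open>(z, q)\<close> at \<open>y\<close>. Long columns at two different vertices \<open>q\<close>
  and \<open>q'\<close> would thus provide two corners at \<open>y\<close> that violate
  \<open>corners_cross\<close>.\<close>

lemma special_inj:
  assumes L: "L \<subseteq> nb v" and "special v L q y" "special v L q' y"
  shows "q = q'"
proof (rule ccontr)
  assume ne: "q \<noteq> q'"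
  obtain y1 where y1: "y1 \<in> col v L q y" "y1 \<noteq> q'"
    using three_elements[of "col v L q y" q' q'] assms by (auto simp: special_def)
  obtain y2 where y2: "y2 \<in> col v L q' y" "y2 \<noteq> q" "y2 \<noteq> y1"
    using three_elements[of "col v L q' y" q y1] assms by (auto simp: special_def)
  have "(y1, q) \<in> corners v L y" "(y2, q') \<in> corners v L y" "y \<in> L"
    using y1 y2 assms by (auto simp: corners_def col_def special_def)
  then show False using corners_cross[OF L, of y y1 q y2 q'] y1 y2 ne by auto
qed

text \<open>At a common member \<open>t\<close> both rows \<open>y\<close> and \<open>y'\<close>
  would be long, but \<open>row_fat\<close> allows row \<open>y'\<close> no entry other than
  \<open>y\<close>.\<close>

lemma special_disjoint:
  assumes L: "L \<subseteq> nb v" and s: "special v L q y" "special v L q' y'" and "y \<noteq> y'"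
  shows "(L \<inter> nb y) \<inter> (L \<inter> nb y') = {}"
proof (rule ccontr)
  \<comment> \<open>The set \<open>L \<inter> nb z\<close> contains \<open>r\<close> and three row
    entries, so at least three elements are left when \<open>t\<close> is removed instead of
    \<open>r\<close>.\<close>
  have big: "3 \<le> card (row v L t z)" if "special v L r z" "t \<in> L \<inter> nb z" for r t z
  proof -
    have r: "3 \<le> card (row v L r z)" "r \<in> L" using that by (auto simp: special_def)
    then obtain p where p: "p \<in> row v L r z" by fastforce
    then have "card (L \<inter> nb z - {r}) \<ge> 3" "r \<in> L \<inter> nb z" "z \<noteq> v"
      using r row_eq[OF p] by (auto simp: row_def corners_def nb_iff)
    then have "card (L \<inter> nb z) \<ge> 4" by simp
    moreover have "row v L t z = L \<inter> nb z - {t}"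
      using that \<open>z \<noteq> v\<close> by (auto simp: row_def corners_def nb_iff)
    ultimately show ?thesis using that by simp
  qed
  assume "\<not> ?thesis"
  then obtain t where t: "t \<in> L \<inter> nb y" "t \<in> L \<inter> nb y'" by blast
  have "3 \<le> card (row v L t y)" "3 \<le> card (row v L t y')" using big s t by blast+
  moreover obtain p where "p \<in> row v L t y'" "p \<noteq> y"
    using three_elements[OF calculation(2), of y y] by blast
  ultimately show False
    using row_fat[OF L, of t y] t \<open>y \<noteq> y'\<close> by (auto simp: row_def)
qed

text \<open>Charge to each special \<open>q\<close> the set \<open>L \<inter> nb (g q)\<close>. It
  contains \<open>q\<close> and three row entries, and these sets are disjoint by
  \<open>special_inj\<close> and \<open>special_disjoint\<close>.\<close>

lemma special_count:
  assumes L: "L \<subseteq> nb v"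
  shows "4 * card {q \<in> L. \<exists>y. special v L q y} \<le> card L"
proof -
  let ?S = "{q \<in> L. \<exists>y. special v L q y}"
  define g where "g q = (SOME y. special v L q y)" for q
  have g: "special v L q (g q)" if "q \<in> ?S" for q
    using that unfolding g_def by (auto intro: someI)
  have finL: "finite L" using L by (rule finite_subset) simp
  have four: "4 \<le> card (L \<inter> nb (g q))" if "q \<in> ?S" for q
  proof -
    have r: "3 \<le> card (row v L q (g q))" "q \<in> L" using g[OF that] by (auto simp: special_def)
    then obtain p where p: "p \<in> row v L q (g q)" by fastforce
    then have "card (L \<inter> nb (g q) - {q}) \<ge> 3" "q \<in> L \<inter> nb (g q)"
      using r row_eq[OF p] by (auto simp: row_def corners_def nb_iff)
    then show ?thesis by simp
  qed
  have "4 * card ?S \<le> (\<Sum>q\<in>?S. card (L \<inter> nb (g q)))"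
    using sum_bounded_below[of ?S 4 "\<lambda>q. card (L \<inter> nb (g q))"] four by simp
  also have "\<dots> = card (\<Union>q\<in>?S. L \<inter> nb (g q))"
  proof (rule card_UN_disjoint[symmetric])
    show "\<forall>q\<in>?S. \<forall>q'\<in>?S. q \<noteq> q' \<longrightarrow> (L \<inter> nb (g q)) \<inter> (L \<inter> nb (g q')) = {}"
    proof (intro ballI impI)
      fix q q' assume q: "q \<in> ?S" "q' \<in> ?S" "q \<noteq> q'"
      have "g q \<noteq> g q'" using special_inj[OF L, of q "g q" q'] g q by metis
      then show "(L \<inter> nb (g q)) \<inter> (L \<inter> nb (g q')) = {}"
        using special_disjoint[OF L g[OF q(1)] g[OF q(2)]] by blast
    qed
  qed (use finL in auto)
  also have "\<dots> \<le> card L" using finL by (intro card_mono) auto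
  finally show ?thesis .
qed

text \<open>The row consists of common neighbours of \<open>v\<close> and \<open>y\<close> other
  than \<open>q\<close>, which takes one off the codegree bound \<open>Suc s\<close>.\<close>

lemma card_row_le:
  assumes L: "L \<subseteq> nb v" and q: "q \<in> L" and codeg: "\<And>u w. u \<noteq> w \<Longrightarrow> card (cn u w) \<le> Suc s"
  shows "card (row v L q y) \<le> s"
proof (cases "row v L q y = {}")
  case False
  then have y: "y \<noteq> v" "q \<in> cn v y" using q L by (auto simp: row_def corners_def nb_iff)
  have "row v L q y \<subseteq> cn v y - {q}" using L by (auto simp: row_def corners_def nb_iff)
  then have "card (row v L q y) \<le> card (cn v y - {q})" by (intro card_mono) auto
  also have "\<dots> = card (cn v y) - 1" using y by (intro card_Diff_singleton)
  finally show ?thesis using codeg[of v y] y by auto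
qed simp

text \<open>Here the common neighbour of \<open>p\<close> and \<open>q\<close> that is left out is
  \<open>v\<close>.\<close>

lemma card_col_le:
  assumes L: "L \<subseteq> nb v" and q: "q \<in> L" and codeg: "\<And>u w. u \<noteq> w \<Longrightarrow> card (cn u w) \<le> Suc s"
  shows "card (col v L q p) \<le> s"
proof (cases "col v L q p = {}")
  case False
  then have p: "p \<noteq> q" "v \<in> cn p q" using q L by (auto simp: col_def corners_def nb_iff adj_sym)
  have "col v L q p \<subseteq> cn p q - {v}" by (auto simp: col_def corners_def nb_iff adj_sym)
  then have "card (col v L q p) \<le> card (cn p q - {v})" by (intro card_mono) auto
  also have "\<dots> = card (cn p q) - 1" using p by (intro card_Diff_singleton)
  finally show ?thesis using codeg[of p q] p by auto
qed simp

text \<open>A long row \<open>y\<close> confines everything to row \<open>y\<close> and column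
  \<open>y\<close>, and that column has at most 2 cells unless \<open>y\<close> is special. If all
  rows are short but some column is long, the count is again a long line plus at most 2.\<close>

lemma card_corners_le:
  assumes L: "L \<subseteq> nb v" and q: "q \<in> L" and codeg: "\<And>u w. u \<noteq> w \<Longrightarrow> card (cn u w) \<le> Suc s"
    and s: "6 \<le> s"
  shows "card (corners v L q) \<le> 2 * s"
    and "(\<nexists>y. special v L q y) \<Longrightarrow> card (corners v L q) \<le> s + 2"
proof -
  let ?C = "corners v L q" and ?r = "row v L q" and ?c = "col v L q"
  note rs = card_row_le[OF L q codeg] and cs = card_col_le[OF L q codeg]
  have fr: "finite (?r y)" for y using L by (rule finite_row)
  have two: "card ?C \<le> card (?r y) + card (?c p)" if "?C \<subseteq> {z} \<times> ?r y \<union> ?c p \<times> {w}" for y p z w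
  proof -
    have "card ?C \<le> card ({z} \<times> ?r y \<union> ?c p \<times> {w})"
      using that fr finite_col by (intro card_mono) auto
    also have "\<dots> \<le> card ({z} \<times> ?r y) + card (?c p \<times> {w})" by (rule card_Un_le)
    finally show ?thesis by (simp add: card_cartesian_product)
  qed
  have "card ?C \<le> 2 * s \<and> ((\<nexists>y. special v L q y) \<longrightarrow> card ?C \<le> s + 2)"
  proof (cases "\<exists>y. 3 \<le> card (?r y)")
    case True
    then obtain y where y: "3 \<le> card (?r y)" by blast
    have "card ?C \<le> card (?r y) + card (?c y)" by (rule two) (rule row_fat[OF L q y])
    moreover have "card (?c y) \<le> 2 \<or> special v L q y" using y q by (auto simp: special_def)
    ultimately show ?thesis using rs[of y] cs[of y] s by auto
  next
    case r: False
    show ?thesis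
    proof (cases "\<exists>p. 3 \<le> card (?c p)")
      case True
      then obtain p where p: "3 \<le> card (?c p)" by blast
      have "card ?C \<le> card (?r p) + card (?c p)"
        by (rule two) (use col_fat[OF L q p] in blast)
      moreover have "card (?r p) \<le> 2" using r by (metis not_less_eq_eq numeral_2_eq_2 numeral_3_eq_3)
      ultimately show ?thesis using cs[of p] s by auto
    next
      case c: False
      have r2: "card (?r y) \<le> 2" and c2: "card (?c y) \<le> 2" for y
        using r c by (metis not_less_eq_eq numeral_2_eq_2 numeral_3_eq_3)+
      \<comment> \<open>When all rows and columns have at most 2 cells, \<open>corners_cross\<close>
        puts every cell into one of four lines determined by a single corner. By
        \<open>6 \<le> s\<close> the resulting 8 is at most \<open>s + 2\<close>.\<close>
      have "card ?C \<le> 8"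
      proof (cases "?C = {}")
        case False
        then obtain y p where yp: "(y, p) \<in> ?C" by auto
        let ?A = "{y} \<times> ?r y \<union> ?c p \<times> {p}" and ?B = "{p} \<times> ?r p \<union> ?c y \<times> {y}"
        have "?C \<subseteq> ?A \<union> ?B"
          using corners_cross[OF L q yp] yp by (fastforce simp: row_def col_def)
        then have "card ?C \<le> card (?A \<union> ?B)"
          using fr finite_col by (intro card_mono) auto
        also have "\<dots> \<le> (card ({y} \<times> ?r y) + card (?c p \<times> {p})) + (card ({p} \<times> ?r p) + card (?c y \<times> {y}))"
          by (meson add_mono card_Un_le le_trans)
        also have "\<dots> \<le> 8"
          using r2[of y] r2[of p] c2[of y] c2[of p] by (simp add: card_cartesian_product)
        finally show ?thesis .
      qed simp
      then show ?thesis using s by auto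
    qed
  qed
  then show "card ?C \<le> 2 * s" and "(\<nexists>y. special v L q y) \<Longrightarrow> card ?C \<le> s + 2" by auto
qed

lemma finite_fans:
  assumes "L \<subseteq> nb v" shows "finite (fans v L)"
proof (rule finite_subset)
  show "fans v L \<subseteq> V \<times> Pow L"
  proof clarify
    fix y P assume f: "(y, P) \<in> fans v L"
    then have "P \<noteq> {}" "P \<subseteq> nb y" by (auto simp: fans_def)
    then obtain p where "adj y p" using nb_iff by blast
    then show "y \<in> V \<and> P \<in> Pow L" using f adj_V by (auto simp: fans_def)
  qed
  show "finite (V \<times> Pow L)" using finite_subset[OF assms] finite_V by simp
qed

text \<open>The trivial estimate is about \<open>s * card L\<close>; a factor below 1 in front of \<open>s\<close> is what makes the deletion
  of the common neighbourhood of a fat pair profitable.\<close>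

lemma card_fans:
  assumes L: "L \<subseteq> nb v" and codeg: "\<And>u w. u \<noteq> w \<Longrightarrow> card (cn u w) \<le> Suc s"
    and s: "6 \<le> s"
  shows "8 * card (fans v L) \<le> (5 * s + 6) * card L"
proof -
  have finL: "finite L" using L by (rule finite_subset) simp
  let ?S = "{q \<in> L. \<exists>y. special v L q y}"
  \<comment> \<open>Each fan is counted at both elements of its pair. At \<open>q\<close> it becomes
    a corner that records the other element.\<close>
  have "2 * card (fans v L) = (\<Sum>F\<in>fans v L. 2)" by simp
  also have "\<dots> = (\<Sum>q\<in>L. card {F \<in> fans v L. q \<in> snd F})"
  proof (rule sum_multicount_gen[symmetric])
    show "\<forall>F\<in>fans v L. card {q \<in> L. q \<in> snd F} = 2"
    proof
      fix F assume "F \<in> fans v L"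
      then have "{q \<in> L. q \<in> snd F} = snd F" "card (snd F) = 2" by (auto simp: fans_def)
      then show "card {q \<in> L. q \<in> snd F} = 2" by simp
    qed
  qed (use finL finite_fans[OF L] in auto)
  also have "\<dots> \<le> (\<Sum>q\<in>L. card (corners v L q))"
  proof (rule sum_mono)
    fix q assume "q \<in> L"
    have "{F \<in> fans v L. q \<in> snd F} \<subseteq> (\<lambda>(y, p). (y, {q, p})) ` corners v L q"
    proof clarsimp
      fix y P assume f: "(y, P) \<in> fans v L" "q \<in> P"
      then obtain p where p: "P = {q, p}" "p \<noteq> q"
        by (auto simp: fans_def card_2_iff doubleton_eq_iff)
      then have "(y, p) \<in> corners v L q" using f by (auto simp: fans_def corners_def nb_iff)
      then show "(y, P) \<in> (\<lambda>(y, p). (y, {q, p})) ` corners v L q" using p by force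
    qed
    then show "card {F \<in> fans v L. q \<in> snd F} \<le> card (corners v L q)"
      using finite_corners[OF L] by (intro surj_card_le)
  qed
  \<comment> \<open>Since \<open>2 * s = (s + 2) + (s - 2)\<close>, a special \<open>q\<close> costs
    an extra \<open>s - 2\<close>; by \<open>special_count\<close> at most a quarter of
    \<open>L\<close> is special.\<close>
  also have "\<dots> \<le> (\<Sum>q\<in>L. (s + 2) + (if \<exists>y. special v L q y then s - 2 else 0))"
    using card_corners_le[OF L _ codeg s] s by (intro sum_mono) fastforce
  also have "\<dots> = card L * (s + 2) + card ?S * (s - 2)"
    using sum.inter_filter[OF finL, of "\<lambda>_. s - 2" "\<lambda>q. \<exists>y. special v L q y"]
    by (simp only: sum.distrib sum_constant add_mult_distrib2 of_nat_id)
  finally have 1: "8 * card (fans v L) \<le> 4 * (card L * (s + 2)) + (4 * card ?S) * (s - 2)" by simp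
  have "(4 * card ?S) * (s - 2) \<le> card L * (s - 2)"
    using special_count[OF L] by (rule mult_right_mono) simp
  then have "8 * card (fans v L) \<le> card L * (4 * (s + 2) + (s - 2))"
    using 1 by (simp add: algebra_simps)
  also have "4 * (s + 2) + (s - 2) = 5 * s + 6" using s by simp
  finally show ?thesis by (simp add: mult.commute)
qed

section \<open>Double counting of 4-cycles and degrees\<close>

lemma C4s_through_sub:
  "{C \<in> C4s (V, E). v \<in> verts C} \<subseteq> (\<lambda>(y, P). C4_of {v, y} P) ` fans v (nb v)"
proof clarify
  have main: "C4_of A B \<in> (\<lambda>(y, P). C4_of {v, y} P) ` fans v (nb v)"
    if "v \<in> A" "card A = 2" "card B = 2" "\<forall>a\<in>A. \<forall>b\<in>B. adj a b" for A B
  proof -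
    from that obtain y where A: "A = {v, y}" "y \<noteq> v" by (auto simp: card_2_iff doubleton_eq_iff)
    then have "(y, B) \<in> fans v (nb v)" using that by (auto simp: fans_def nb_iff)
    then show ?thesis using A by force
  qed
  fix X F assume C: "(X, F) \<in> C4s (V, E)" and v: "v \<in> verts (X, F)"
  then obtain A B where C: "(X, F) = C4_of A B" and c: "card A = 2" "card B = 2"
      and ad: "\<forall>a\<in>A. \<forall>b\<in>B. adj a b" unfolding C4s_eq by blast
  have ad': "\<forall>a\<in>B. \<forall>b\<in>A. adj a b" using ad adj_sym by blast
  have "v \<in> A \<or> v \<in> B" using v unfolding C by (simp add: C4_of_def)
  then show "(X, F) \<in> (\<lambda>(y, P). C4_of {v, y} P) ` fans v (nb v)"
    using main[OF _ c ad] main[OF _ c(2,1) ad'] unfolding C C4_of_commute[of B A] by blast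
qed

lemma card_C4s_through:
  "card {C \<in> C4s (V, E). v \<in> verts C} \<le> card (fans v (nb v))"
  using C4s_through_sub finite_fans by (intro surj_card_le) auto

lemma sum_C4s_through: "4 * card (C4s (V, E)) = (\<Sum>v\<in>V. card {C \<in> C4s (V, E). v \<in> verts C})"
proof -
  have "(\<Sum>v\<in>V. card {C \<in> C4s (V, E). v \<in> verts C}) = (\<Sum>C\<in>C4s (V, E). 4)"
  proof (rule sum_multicount_gen)
    show "\<forall>C\<in>C4s (V, E). card {v \<in> V. v \<in> verts C} = 4"
    proof
      fix C assume "C \<in> C4s (V, E)"
      then obtain A B where C: "C = C4_of A B" and c: "card A = 2" "card B = 2"
        and ad: "\<forall>a\<in>A. \<forall>b\<in>B. adj a b" unfolding C4s_eq by blast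
      have ne: "A \<noteq> {}" "B \<noteq> {}" "finite A" "finite B" using c by (auto intro: card_ge_0_finite)
      then have "A \<subseteq> V" "B \<subseteq> V" using ad adj_V by blast+
      then have "{v \<in> V. v \<in> verts C} = A \<union> B" unfolding C by (auto simp: C4_of_def)
      then show "card {v \<in> V. v \<in> verts C} = 4"
        using c ne C4_of_disjoint[OF ad] by (simp add: card_Un_disjoint)
    qed
  qed (use finite_V finite_C4s in auto)
  then show ?thesis by simp
qed

text \<open>Count the triples \<open>(v, p, q)\<close> with \<open>p\<close> and \<open>q\<close>
  neighbours of \<open>v\<close>. For fixed \<open>p \<noteq> q\<close> there are at most
  \<open>k\<close> of them, and the case \<open>p = q\<close> adds the degree sum.\<close>

lemma sum_degree_squares:
  assumes codeg: "\<And>u w. u \<noteq> w \<Longrightarrow> card (cn u w) \<le> k"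
  shows "(\<Sum>v\<in>V. (card (nb v))\<^sup>2) \<le> k * (card V)\<^sup>2 + (\<Sum>v\<in>V. card (nb v))"
proof -
  have "(\<Sum>v\<in>V. (card (nb v))\<^sup>2) = (\<Sum>v\<in>V. card {j \<in> V \<times> V. fst j \<in> nb v \<and> snd j \<in> nb v})"
  proof (rule sum.cong)
    fix v
    have "{j \<in> V \<times> V. fst j \<in> nb v \<and> snd j \<in> nb v} = nb v \<times> nb v" using nb_V by auto
    then show "(card (nb v))\<^sup>2 = card {j \<in> V \<times> V. fst j \<in> nb v \<and> snd j \<in> nb v}"
      by (simp add: card_cartesian_product power2_eq_square)
  qed simp
  also have "\<dots> = (\<Sum>j\<in>V \<times> V. card {v \<in> V. fst j \<in> nb v \<and> snd j \<in> nb v})"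
    by (rule sum_multicount_gen) (use finite_V in auto)
  also have "\<dots> = (\<Sum>p\<in>V. \<Sum>q\<in>V. card (cn p q))"
  proof -
    have "{v \<in> V. p \<in> nb v \<and> q \<in> nb v} = cn p q" for p q
      using adj_V by (auto simp: nb_iff adj_sym)
    then show ?thesis unfolding sum.cartesian_product by (intro sum.cong) auto
  qed
  also have "\<dots> \<le> (\<Sum>p\<in>V. \<Sum>q\<in>V. k + (if q = p then card (nb p) else 0))"
  proof (intro sum_mono)
    fix p q show "card (cn p q) \<le> k + (if q = p then card (nb p) else 0)"
      using codeg[of p q] by auto
  qed
  also have "\<dots> = k * (card V)\<^sup>2 + (\<Sum>v\<in>V. card (nb v))"
    using finite_V by (simp add: sum.distrib power2_eq_square)
  finally show ?thesis .
qed

text \<open>With \<open>s = 6\<close>, \<open>card_fans\<close> bounds the number of 4-cycles by a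
  multiple of the degree sum, and \<open>sum_degree_squares\<close> bounds the degree sum. The
  resulting bound is about \<open>n^2 / 5\<close>, against the target of about
  \<open>n^2 / 2\<close>.\<close>

lemma small_codegree:
  assumes codeg: "\<And>u w. u \<noteq> w \<Longrightarrow> card (cn u w) \<le> 7" and n: "card V \<ge> 50"
  shows "card (C4s (V, E)) < (card V - 2) choose 2"
proof -
  let ?n = "card V" and ?D = "\<Sum>v\<in>V. card (nb v)"
  have f: "8 * card {C \<in> C4s (V, E). v \<in> verts C} \<le> 36 * card (nb v)" for v
  proof -
    have "8 * card (fans v (nb v)) \<le> (5 * 6 + 6) * card (nb v)"
      by (rule card_fans) (use codeg in auto)
    then have "8 * card (fans v (nb v)) \<le> 36 * card (nb v)" by simp
    then show ?thesis using card_C4s_through[of v] by linarith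
  qed
  have "8 * (4 * card (C4s (V, E))) = (\<Sum>v\<in>V. 8 * card {C \<in> C4s (V, E). v \<in> verts C})"
    unfolding sum_C4s_through by (simp add: sum_distrib_left)
  also have "\<dots> \<le> 36 * ?D" unfolding sum_distrib_left by (intro sum_mono f)
  finally have 1: "32 * card (C4s (V, E)) \<le> 36 * ?D" by simp
  \<comment> \<open>The gap \<open>(d - 20) * (d - 21)\<close> is nonnegative at integers. The
    factor 41 drops to 40 when the degree sum from \<open>sum_degree_squares\<close> is
    subtracted.\<close>
  have "41 * d \<le> d\<^sup>2 + 420" for d :: nat
  proof -
    have "0 \<le> (int d - 20) * (int d - 21)"
      by (cases "d \<le> 20") (simp_all add: mult_nonpos_nonpos)
    then have "41 * int d \<le> (int d)\<^sup>2 + 420" by (simp add: algebra_simps power2_eq_square)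
    then have "int (41 * d) \<le> int (d\<^sup>2 + 420)" by simp
    then show ?thesis unfolding of_nat_le_iff .
  qed
  then have "(\<Sum>v\<in>V. 41 * card (nb v)) \<le> (\<Sum>v\<in>V. (card (nb v))\<^sup>2 + 420)" by (intro sum_mono)
  then have "41 * ?D \<le> (\<Sum>v\<in>V. (card (nb v))\<^sup>2) + 420 * ?n"
    by (simp add: sum_distrib_left sum.distrib)
  also have "\<dots> \<le> 7 * ?n\<^sup>2 + ?D + 420 * ?n" using sum_degree_squares[OF codeg] by simp
  finally have 2: "40 * ?D \<le> 7 * ?n\<^sup>2 + 420 * ?n" by simp
  \<comment> \<open>After the shift by 50 the remaining comparison of quadratics holds coefficient
    by coefficient.\<close>
  obtain k where k: "?n = k + 50" using le_Suc_ex[OF n] by (auto simp: add.commute)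
  have 3: "2 * ((?n - 2) choose 2) = (k + 48) * (k + 47)" unfolding choose_two_double k by (simp add: add.commute)
  have "1280 * card (C4s (V, E)) \<le> 36 * (40 * ?D)" using 1 by simp
  also have "\<dots> \<le> 36 * (7 * ?n\<^sup>2 + 420 * ?n)" using 2 by (rule mult_le_mono2)
  also have "\<dots> < 640 * ((k + 48) * (k + 47))"
    unfolding k by (simp add: power2_eq_square algebra_simps)
  finally show ?thesis using 3 by linarith
qed

end

section \<open>A pair of large codegree\<close>

text \<open>Here \<open>s\<close> is one less than the maximal codegree, to match
  \<open>card_fans\<close>. So \<open>7 \<le> s\<close> is exactly the range left over by
  \<open>small_codegree\<close>.\<close>

locale fat_pair = C6_free_graph +
  fixes a b :: 'a and s :: nat
  assumes ab: "a \<noteq> b" and card_cn: "card (cn a b) = Suc s" and s: "7 \<le> s"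
    and codeg: "\<And>u w. u \<noteq> w \<Longrightarrow> card (cn u w) \<le> Suc s"
begin

definition N :: "'a set" where "N = cn a b"

definition R :: "'a set" where "R = V - N - {a, b}"

lemma finite_N [simp]: "finite N" by (simp add: N_def)

lemma finite_R [simp]: "finite R" using finite_V by (simp add: R_def)

lemma N_iff: "x \<in> N \<longleftrightarrow> adj a x \<and> adj b x" by (auto simp: N_def nb_iff)

lemma N_V: "N \<subseteq> V" using nb_V by (auto simp: N_def)

lemma ab_notin_N [simp]: "a \<notin> N" "b \<notin> N" by (auto simp: N_iff)

lemma card_N: "card N = Suc s" using card_cn by (simp add: N_def)

lemma ab_in_V: "a \<in> V" "b \<in> V"
proof -
  have "N \<noteq> {}" using card_cn by (auto simp: N_def)
  then show "a \<in> V" "b \<in> V" using adj_V by (auto simp: N_iff)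
qed

lemma card_V: "card V = Suc s + card R + 2"
proof -
  have "V = N \<union> (R \<union> {a, b})" "N \<inter> (R \<union> {a, b}) = {}" "R \<inter> {a, b} = {}"
    using ab_in_V N_V by (auto simp: R_def)
  then have "card V = card N + (card R + card {a, b})"
    using card_Un_disjoint[of N "R \<union> {a, b}"] card_Un_disjoint[of R "{a, b}"] by simp
  then show ?thesis using card_cn ab by (simp add: N_def)
qed

section \<open>Edges inside and into the common neighbourhood\<close>

lemma cn_N: "x \<in> N \<Longrightarrow> y \<in> N \<Longrightarrow> x \<noteq> y \<Longrightarrow> cn x y = {a, b}"
  using cn_of_fat[of a b x y] ab card_cn s by (simp add: N_def)

text \<open>Supplies the vertex that joins \<open>a\<close> and \<open>b\<close> when a path between
  them is closed to a hexagon.\<close>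

lemma ex_N:
  obtains z where "z \<in> N" "z \<notin> {x1, x2, x3}"
proof -
  have "card {x1, x2, x3} \<le> 3" by (simp add: card_insert_if)
  then have "\<not> N \<subseteq> {x1, x2, x3}"
    using card_mono[of "{x1, x2, x3}" N] card_cn s by (auto simp: N_def)
  then show ?thesis using that by blast
qed

text \<open>Otherwise \<open>a x1 x2 x3 b z\<close> would be a hexagon.\<close>

lemma N_path:
  assumes "x1 \<in> N" "x2 \<in> N" "x3 \<in> N" "adj x1 x2" "adj x2 x3"
  shows "x1 = x3"
proof (rule ccontr)
  assume ne: "x1 \<noteq> x3"
  obtain z where z: "z \<in> N" "z \<notin> {x1, x2, x3}" using ex_N .
  have "adj a x1" "adj x1 x2" "adj x2 x3" "adj x3 b" "adj b z" "adj z a"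
    using assms z by (auto simp: N_iff adj_sym)
  moreover have "distinct [a, x1, x2, x3, b, z]"
    using assms z ne ab by (auto simp: N_iff)
  ultimately show False by (rule no_hexagon)
qed

text \<open>Two disjoint edges would close the hexagon \<open>a x x' b y y'\<close>; edges that
  share a vertex fall under \<open>N_path\<close>.\<close>

lemma N_edges:
  assumes "x \<in> N" "x' \<in> N" "y \<in> N" "y' \<in> N" "adj x x'" "adj y y'"
  shows "{x, x'} = {y, y'}"
proof (cases "{x, x'} \<inter> {y, y'} = {}")
  case True
  have "adj a x" "adj x x'" "adj x' b" "adj b y" "adj y y'" "adj y' a"
    using assms by (auto simp: N_iff adj_sym)
  moreover have "distinct [a, x, x', b, y, y']"
    using assms True ab by (auto simp: N_iff)
  ultimately have False by (rule no_hexagon)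
  then show ?thesis ..
next
  case False
  have sym: "adj x' x" "adj y' y" using assms(5,6) by (simp_all add: adj_sym)
  consider "x = y" | "x = y'" | "x' = y" | "x' = y'" using False by blast
  then show ?thesis
  proof cases
    case 1 then show ?thesis using N_path[of x' x y'] assms sym by simp
  next
    case 2 then show ?thesis using N_path[of x' x y] assms sym by (simp add: insert_commute)
  next
    case 3 then show ?thesis using N_path[of x x' y'] assms sym by (simp add: insert_commute)
  next
    case 4 then show ?thesis using N_path[of x x' y] assms sym by simp
  qed
qed

text \<open>Otherwise \<open>y\<close> would be a third common neighbour of \<open>x\<close> and
  \<open>x'\<close>, besides \<open>a\<close> and \<open>b\<close>.\<close>

lemma R_N_unique: "y \<in> R \<Longrightarrow> x \<in> N \<Longrightarrow> x' \<in> N \<Longrightarrow> adj y x \<Longrightarrow> adj y x' \<Longrightarrow> x = x'"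
proof (rule ccontr)
  assume y: "y \<in> R" and x: "x \<in> N" "x' \<in> N" and "adj y x" "adj y x'" and ne: "x \<noteq> x'"
  then have "y \<in> cn x x'" by (simp add: nb_iff adj_sym)
  then show False using cn_N[OF x ne] y by (simp add: R_def)
qed

definition L :: "'a \<Rightarrow> 'a set" where "L x = nb x - {a, b}"

lemma L_sub: "L x \<subseteq> nb x" by (auto simp: L_def)

lemma finite_L [simp]: "finite (L x)" by (simp add: L_def)

text \<open>By \<open>R_N_unique\<close> each vertex of \<open>R\<close> is counted at most once.
  The summand 2 comes from the two ends of the only possible edge inside \<open>N\<close>.\<close>

lemma sum_card_L: "(\<Sum>x\<in>N. card (L x)) \<le> card R + 2"
proof -
  have L: "card (L x) = card (nb x \<inter> R) + card (nb x \<inter> N)" for x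
  proof -
    have "L x = (nb x \<inter> R) \<union> (nb x \<inter> N)" "(nb x \<inter> R) \<inter> (nb x \<inter> N) = {}"
      using nb_V[of x] by (auto simp: L_def R_def)
    then show ?thesis using card_Un_disjoint[of "nb x \<inter> R" "nb x \<inter> N"] by simp
  qed
  have "(\<Sum>x\<in>N. card (nb x \<inter> R)) = card (SIGMA x:N. nb x \<inter> R)" by simp
  also have "\<dots> \<le> card R"
  proof (rule card_inj_on_le)
    show "inj_on snd (SIGMA x:N. nb x \<inter> R)"
    proof (rule inj_onI, clarify)
      fix x y x' y' assume "x \<in> N" "y \<in> nb x" "y \<in> R" "x' \<in> N" "y' \<in> nb x'" "snd (x, y) = snd (x', y')"
      then show "x = x' \<and> y = y'" using R_N_unique[of y x x'] adj_sym by (simp add: nb_iff)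
    qed
  qed auto
  finally have 1: "(\<Sum>x\<in>N. card (nb x \<inter> R)) \<le> card R" .
  have "card (SIGMA x:N. nb x \<inter> N) \<le> 2"
  proof (cases "(SIGMA x:N. nb x \<inter> N) = {}")
    case False
    then obtain x x' where x: "x \<in> N" "x' \<in> N" "adj x x'" by (auto simp: nb_iff)
    have "(SIGMA x:N. nb x \<inter> N) \<subseteq> {(x, x'), (x', x)}"
    proof
      fix z assume "z \<in> (SIGMA x:N. nb x \<inter> N)"
      then obtain u w where z: "z = (u, w)" and u: "u \<in> N" "w \<in> N" "adj u w" by (auto simp: nb_iff)
      then show "z \<in> {(x, x'), (x', x)}"
        using N_edges[OF x(1,2) u(1,2) x(3) u(3)] by (auto simp: doubleton_eq_iff)
    qed
    then have "card (SIGMA x:N. nb x \<inter> N) \<le> card {(x, x'), (x', x)}" by (rule card_mono[rotated]) simp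
    moreover have "x \<noteq> x'" using x(3) by auto
    ultimately show ?thesis by simp
  qed (simp only: card.empty)
  then show ?thesis using 1 by (simp add: L sum.distrib)
qed

text \<open>If \<open>P = {p, c}\<close> with exactly \<open>c\<close> in \<open>{a, b}\<close> and
  \<open>d\<close> is the other vertex of that pair, then \<open>x p y c z d\<close> is a hexagon
  for some \<open>z \<in> N\<close> unless \<open>y = d\<close>. The case \<open>P = {a, b}\<close>
  would put \<open>y\<close> into \<open>N\<close>.\<close>

lemma opposite_outside:
  assumes x: "x \<in> N" and y: "y \<notin> N" "y \<noteq> x" and P: "card P = 2" "P \<subseteq> cn x y"
  shows "P \<subseteq> L x \<or> (\<exists>p\<in>L x. y = b \<and> P = {a, p}) \<or> (\<exists>p\<in>L x. y = a \<and> P = {b, p})"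
proof -
  have main: "y = d"
    if c: "c = a \<and> d = b \<or> c = b \<and> d = a" "p \<notin> {a, b}" "adj x p" "adj y p" "adj y c" for c d p
  proof (rule ccontr)
    assume ne: "y \<noteq> d"
    obtain z where z: "z \<in> N" "z \<notin> {x, p, y}" using ex_N .
    note cd = c(1)
    have "adj x p" "adj p y" "adj y c" "adj c z" "adj z d" "adj d x"
      using c(3-5) x z(1) cd by (auto simp: N_iff adj_sym)
    moreover have "distinct [x, p, y, c, z, d]"
      using c(2-5) x y z cd ab ne by (auto simp: N_iff)
    ultimately show False by (rule no_hexagon)
  qed
  obtain p q where P2: "P = {p, q}" "p \<noteq> q" using P(1) by (auto simp: card_2_iff)
  have ad: "adj x p" "adj x q" "adj y p" "adj y q" using P(2) by (auto simp: P2 nb_iff)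
  have not_ab: "{p, q} \<noteq> {a, b}" using ad y by (auto simp: N_iff adj_sym doubleton_eq_iff)
  consider "p \<notin> {a, b}" "q \<notin> {a, b}" | "p \<notin> {a, b}" "q \<in> {a, b}" | "p \<in> {a, b}" "q \<notin> {a, b}"
    using not_ab P2 by (auto simp: doubleton_eq_iff)
  then show ?thesis
  proof cases
    case 1
    then show ?thesis using ad by (auto simp: P2 L_def nb_iff)
  next
    case 2
    then have "q = a \<and> y = b \<or> q = b \<and> y = a"
      using main[of a b p] main[of b a p] ad by blast
    moreover have "p \<in> L x" using 2 ad by (simp add: L_def nb_iff)
    ultimately show ?thesis unfolding P2 by blast
  next
    case 3
    then have "p = a \<and> y = b \<or> p = b \<and> y = a"
      using main[of a b q] main[of b a q] ad by blast
    moreover have "q \<in> L x" using 3 ad by (simp add: L_def nb_iff)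
    ultimately show ?thesis unfolding P2 by blast
  qed
qed

text \<open>Candidates for the opposite vertex and the other diagonal of a 4-cycle through
  \<open>x \<in> N\<close> with opposite vertex outside \<open>N\<close>, in the three kinds of
  \<open>opposite_outside\<close>. It serves for upper bounds: the candidates of the last two kinds
  may fail to be 4-cycles.\<close>

definition outer :: "'a \<Rightarrow> ('a \<times> 'a set) set" where
  "outer x = fans x (L x) \<union> (\<lambda>p. (b, {a, p})) ` L x \<union> (\<lambda>p. (a, {b, p})) ` L x"

lemma finite_outer: "finite (outer x)"
  using finite_fans[OF L_sub] by (simp add: outer_def)

text \<open>Two additional candidates for each \<open>p \<in> L x\<close> raise the 6 of
  \<open>card_fans\<close> by \<open>8 * 2\<close> to 22.\<close>

lemma card_outer: "8 * card (outer x) \<le> (5 * s + 22) * card (L x)"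
proof -
  have "card (outer x) \<le> card (fans x (L x)) + card ((\<lambda>p. (b, {a, p})) ` L x) + card ((\<lambda>p. (a, {b, p})) ` L x)"
    unfolding outer_def by (meson add_mono card_Un_le le_refl le_trans)
  also have "\<dots> \<le> card (fans x (L x)) + card (L x) + card (L x)"
    by (intro add_mono card_image_le le_refl finite_L)
  finally have "card (outer x) \<le> card (fans x (L x)) + 2 * card (L x)" by simp
  moreover have "8 * card (fans x (L x)) \<le> (5 * s + 6) * card (L x)"
    using s by (intro card_fans L_sub codeg) auto
  moreover have "(5 * s + 22) * card (L x) = (5 * s + 6) * card (L x) + 16 * card (L x)"
    by (simp add: algebra_simps)
  ultimately show ?thesis by linarith
qed

text \<open>Let \<open>y\<close> be opposite to a vertex \<open>x \<in> N\<close> of the 4-cycle. If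
  \<open>y \<in> N\<close>, then \<open>cn_N\<close> forces the other diagonal to be
  \<open>{a, b}\<close>; otherwise \<open>opposite_outside\<close> applies.\<close>

lemma touching_N_sub:
  "{C \<in> C4s (V, E). verts C \<inter> N \<noteq> {}} \<subseteq>
     (\<lambda>P. C4_of P {a, b}) ` {P. P \<subseteq> N \<and> card P = 2} \<union> (\<Union>x\<in>N. (\<lambda>(y, P). C4_of {x, y} P) ` outer x)"
    (is "_ \<subseteq> ?M")
proof
  have main: "C4_of A B \<in> ?M"
    if x: "x \<in> A" "x \<in> N" and c: "card A = 2" "card B = 2" and ad: "\<forall>u\<in>A. \<forall>w\<in>B. adj u w" for A B x
  proof -
    obtain y where A: "A = {x, y}" "y \<noteq> x" using x c by (auto simp: card_2_iff doubleton_eq_iff)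
    have B: "B \<subseteq> cn x y" using ad A by (auto simp: nb_iff)
    show ?thesis
    proof (cases "y \<in> N")
      case True
      then have "B \<subseteq> {a, b}" using B cn_N[of x y] x A by auto
      then have "B = {a, b}" using c ab by (intro card_subset_eq) auto
      then show ?thesis using A x c True by blast
    next
      case False
      have "(y, B) \<in> outer x"
        using opposite_outside[OF x(2) False A(2) c(2) B] A c B by (auto simp: outer_def fans_def)
      then show ?thesis using x A by force
    qed
  qed
  fix C assume "C \<in> {C \<in> C4s (V, E). verts C \<inter> N \<noteq> {}}"
  then obtain A B x where C: "C = C4_of A B" and c: "card A = 2" "card B = 2"
      and ad: "\<forall>a\<in>A. \<forall>b\<in>B. adj a b" and x: "x \<in> N" "x \<in> verts C" unfolding C4s_eq by blast
  have ad': "\<forall>a\<in>B. \<forall>b\<in>A. adj a b" using ad adj_sym by blast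
  have "x \<in> A \<or> x \<in> B" using x unfolding C by (simp add: C4_of_def)
  then show "C \<in> ?M"
    using main[OF _ x(1) c ad] main[OF _ x(1) c(2,1) ad'] unfolding C C4_of_commute[of B A] by blast
qed

lemma card_touching_N:
  "8 * card {C \<in> C4s (V, E). verts C \<inter> N \<noteq> {}} \<le> 8 * (Suc s choose 2) + (5 * s + 22) * (card R + 2)"
proof -
  let ?P = "{P. P \<subseteq> N \<and> card P = 2}"
  have finP: "finite ?P" by (rule finite_subset[of _ "Pow N"]) auto
  have "card {C \<in> C4s (V, E). verts C \<inter> N \<noteq> {}} \<le>
      card ((\<lambda>P. C4_of P {a, b}) ` ?P \<union> (\<Union>x\<in>N. (\<lambda>(y, P). C4_of {x, y} P) ` outer x))"
    using finP finite_outer by (intro card_mono touching_N_sub) auto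
  also have "\<dots> \<le> card ((\<lambda>P. C4_of P {a, b}) ` ?P) + card (\<Union>x\<in>N. (\<lambda>(y, P). C4_of {x, y} P) ` outer x)"
    by (rule card_Un_le)
  also have "\<dots> \<le> card ?P + (\<Sum>x\<in>N. card (outer x))"
  proof (rule add_mono)
    show "card ((\<lambda>P. C4_of P {a, b}) ` ?P) \<le> card ?P" using finP by (rule card_image_le)
    have "card (\<Union>x\<in>N. (\<lambda>(y, P). C4_of {x, y} P) ` outer x) \<le>
        (\<Sum>x\<in>N. card ((\<lambda>(y, P). C4_of {x, y} P) ` outer x))"
      by (rule card_UN_le) simp
    also have "\<dots> \<le> (\<Sum>x\<in>N. card (outer x))"
      by (intro sum_mono card_image_le finite_outer)
    finally show "card (\<Union>x\<in>N. (\<lambda>(y, P). C4_of {x, y} P) ` outer x) \<le> (\<Sum>x\<in>N. card (outer x))" .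
  qed
  also have "card ?P = Suc s choose 2" using n_subsets[OF finite_N, of 2] card_N by simp
  finally have 1: "card {C \<in> C4s (V, E). verts C \<inter> N \<noteq> {}} \<le> (Suc s choose 2) + (\<Sum>x\<in>N. card (outer x))" .
  have "8 * (\<Sum>x\<in>N. card (outer x)) \<le> (5 * s + 22) * (\<Sum>x\<in>N. card (L x))"
    unfolding sum_distrib_left by (intro sum_mono card_outer)
  also have "\<dots> \<le> (5 * s + 22) * (card R + 2)" using sum_card_L by (rule mult_left_mono) simp
  finally have 2: "8 * (\<Sum>x\<in>N. card (outer x)) \<le> (5 * s + 22) * (card R + 2)" .
  have "8 * card {C \<in> C4s (V, E). verts C \<inter> N \<noteq> {}}
      \<le> 8 * (Suc s choose 2) + 8 * (\<Sum>x\<in>N. card (outer x))"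
    using mult_le_mono2[OF 1, of 8] by (simp only: add_mult_distrib2)
  also have "\<dots> \<le> 8 * (Suc s choose 2) + (5 * s + 22) * (card R + 2)"
    using 2 by (rule add_left_mono)
  finally show ?thesis .
qed

section \<open>Deleting \<open>N\<close> or a vertex of \<open>R\<close>\<close>

lemma remove_N:
  assumes n: "card V > 250" and r: "7 \<le> card R"
  shows "card {C \<in> C4s (V, E). verts C \<inter> N \<noteq> {}} + card N + ((card V - card N - 2) choose 2)
    \<le> (card V - 2) choose 2"
proof -
  let ?r = "card R"
  have m: "card N = Suc s" using card_cn by (simp add: N_def)
  \<comment> \<open>This is 8 times the claim after the pairs inside \<open>N\<close> and inside
    \<open>R\<close> cancel. Right side minus left side is
    \<open>s * (3 * ?r - 18) - 14 * ?r - 52\<close>: the coefficient of \<open>s\<close> is positive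
    from \<open>?r = 7\<close> on, and at \<open>s = 7\<close> the value is nonnegative from
    \<open>?r = 26\<close> on.\<close>
  have key: "(5 * s + 22) * (?r + 2) + 8 * Suc s \<le> 8 * (Suc s * ?r)"
  proof (cases "?r \<ge> 26")
    case True
    then obtain k where k: "?r = k + 26" using le_Suc_ex[OF True] by (auto simp: add.commute)
    obtain t where t: "s = t + 7" using le_Suc_ex[OF s] by (auto simp: add.commute)
    show ?thesis unfolding k t by (simp add: algebra_simps)
  next
    case False
    \<comment> \<open>If \<open>R\<close> is small, almost all of the more than 250 vertices lie in
      \<open>N\<close>, and a large \<open>s\<close> outweighs the small coefficient.\<close>
    then have "s \<ge> 222" using n card_V by linarith
    then obtain t where t: "s = t + 222" using le_Suc_ex by (metis add.commute)
    obtain k where k: "?r = k + 7" using le_Suc_ex[OF r] by (auto simp: add.commute)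
    show ?thesis unfolding k t by (simp add: algebra_simps)
  qed
  have "card V - card N - 2 = ?r" "card V - 2 = Suc s + ?r" using card_V m by simp_all
  then show ?thesis
    using card_touching_N key choose_two_add[of "Suc s" ?r] unfolding m by simp
qed

text \<open>Since \<open>y \<notin> N\<close>, its two neighbours on a 4-cycle are not
  \<open>a\<close> and \<open>b\<close>, so one of them has degree at most 9 and leaves at most 9
  opposite vertices. This gives at most \<open>9 * (7 choose 2) = 189\<close> 4-cycles through
  \<open>y\<close>, while the target drops by \<open>card V - 3\<close>, which is at least
  248.\<close>

lemma remove_vertex:
  assumes n: "card V > 250" and r: "card R \<le> 6" and y: "y \<in> R"
  shows "card {C \<in> C4s (V, E). verts C \<inter> {y} \<noteq> {}} + 1 + ((card V - 1 - 2) choose 2)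
    \<le> (card V - 2) choose 2"
proof -
  have deg_N: "card (nb p) \<le> 9" if p: "p \<in> N" for p
  proof -
    \<comment> \<open>The bound 9 is \<open>2 + 6 + 1\<close>, since \<open>p\<close> has at most
      one neighbour in \<open>N\<close>.\<close>
    have "nb p \<subseteq> {a, b} \<union> R \<union> (nb p \<inter> N)" using nb_V[of p] by (auto simp: R_def)
    moreover have "card (nb p \<inter> N) \<le> 1"
      using N_path[OF _ p] by (intro card_le_Suc0_iff_eq[THEN iffD2, simplified One_nat_def[symmetric]])
        (auto simp: nb_iff adj_sym)
    moreover have "card ({a, b} \<union> R \<union> (nb p \<inter> N)) \<le> card {a, b} + card R + card (nb p \<inter> N)"
      by (meson add_mono card_Un_le le_refl le_trans)
    moreover have "card {a, b} \<le> 2" by (simp add: card_insert_if)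
    ultimately show ?thesis
      using card_mono[of "{a, b} \<union> R \<union> (nb p \<inter> N)" "nb p"] r by auto
  qed
  have deg_R: "card (nb p) \<le> 7" if p: "p \<in> R" for p
  proof -
    \<comment> \<open>The bound 7 is \<open>1 + 5 + 1\<close>: a neighbour of both \<open>a\<close>
      and \<open>b\<close> would lie in \<open>N\<close>.\<close>
    have "nb p \<subseteq> (nb p \<inter> {a, b}) \<union> (R - {p}) \<union> (nb p \<inter> N)"
      using nb_V[of p] by (auto simp: R_def nb_iff)
    moreover have "card (nb p \<inter> N) \<le> 1"
      using R_N_unique[OF p] by (intro card_le_Suc0_iff_eq[THEN iffD2, simplified One_nat_def[symmetric]])
        (auto simp: nb_iff adj_sym)
    moreover have "card (nb p \<inter> {a, b}) \<le> 1"
      using p by (intro card_le_Suc0_iff_eq[THEN iffD2, simplified One_nat_def[symmetric]])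
        (auto simp: nb_iff adj_sym R_def N_iff)
    moreover have "card ((nb p \<inter> {a, b}) \<union> (R - {p}) \<union> (nb p \<inter> N)) \<le>
        card (nb p \<inter> {a, b}) + card (R - {p}) + card (nb p \<inter> N)"
      by (meson add_mono card_Un_le le_refl le_trans)
    moreover have "card (R - {p}) \<le> 5" using p r by simp
    ultimately show ?thesis
      using card_mono[of "(nb p \<inter> {a, b}) \<union> (R - {p}) \<union> (nb p \<inter> N)" "nb p"] by auto
  qed
  let ?P = "{P. P \<subseteq> nb y \<and> card P = 2}" and ?T = "\<lambda>P. {z. P \<subseteq> nb z}"
  have finP: "finite ?P" by (rule finite_subset[of _ "Pow (nb y)"]) auto
  have T: "finite (?T P) \<and> card (?T P) \<le> 9" if "P \<in> ?P" for P
  proof -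
    have "\<exists>p\<in>P. p \<notin> {a, b}"
    proof (rule ccontr)
      assume "\<not> ?thesis"
      then have "P = {a, b}" using that ab by (intro card_subset_eq) auto
      then show False using that y by (auto simp: R_def N_iff nb_iff adj_sym)
    qed
    then obtain p where p: "p \<in> P" "p \<notin> {a, b}" by blast
    then have "p \<in> N \<or> p \<in> R" using that nb_V[of y] by (auto simp: R_def)
    then have "card (nb p) \<le> 9" using deg_N deg_R by fastforce
    moreover have "?T P \<subseteq> nb p" using p by (auto simp: nb_iff adj_sym)
    ultimately show ?thesis using card_mono[of "nb p" "?T P"] finite_subset[of "?T P" "nb p"] by auto
  qed
  have "card (fans y (nb y)) \<le> card (SIGMA P:?P. ?T P)"
  proof (rule surj_card_le)
    show "fans y (nb y) \<subseteq> (\<lambda>(P, z). (z, P)) ` (SIGMA P:?P. ?T P)" by (force simp: fans_def)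
    show "finite (SIGMA P:?P. ?T P)" using finP T by (intro finite_SigmaI) auto
  qed
  also have "\<dots> = (\<Sum>P\<in>?P. card (?T P))" using finP T by (intro card_SigmaI) auto
  also have "\<dots> \<le> 9 * card ?P" using sum_bounded_above[of ?P "\<lambda>P. card (?T P)" 9] T by auto
  also have "card ?P = card (nb y) choose 2" by (simp add: n_subsets)
  also have "9 * (card (nb y) choose 2) \<le> 9 * (7 choose 2)"
    using deg_R[OF y] by (intro mult_le_mono2 binomial_right_mono)
  also have "\<dots> = 189" by (simp add: choose_two)
  finally have "card {C \<in> C4s (V, E). verts C \<inter> {y} \<noteq> {}} \<le> 189"
    using card_C4s_through[of y] by simp
  moreover have "(card V - 2) choose 2 = ((card V - 1 - 2) choose 2) + (card V - 1 - 2)"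
  proof -
    have "card V - 2 = Suc (card V - 1 - 2)" using n by simp
    moreover have "Suc k choose 2 = (k choose 2) + k" for k by (simp add: numeral_2_eq_2)
    ultimately show ?thesis by presburger
  qed
  ultimately show ?thesis using n by linarith
qed

text \<open>If a diagonal lies inside \<open>N\<close>, the other one is \<open>{a, b}\<close>. If
  neither does, each contains exactly one of \<open>a\<close> and \<open>b\<close>; then
  \<open>a\<close> and \<open>b\<close> are adjacent, and so are the two remaining vertices, which
  lie in \<open>N\<close>.\<close>

lemma C4s_span:
  assumes R: "R = {}" and no: "\<not> (adj a b \<and> (\<exists>x\<in>N. \<exists>y\<in>N. adj x y))"
  shows "card (C4s (V, E)) \<le> Suc s choose 2"
proof -
  let ?P = "{P. P \<subseteq> N \<and> card P = 2}"
  have V: "V \<subseteq> N \<union> {a, b}" using R by (auto simp: R_def)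
  have main: "C4_of A B \<in> (\<lambda>P. C4_of P {a, b}) ` ?P"
    if A: "A \<subseteq> N" and c: "card A = 2" "card B = 2" and ad: "\<forall>u\<in>A. \<forall>w\<in>B. adj u w" for A B
  proof -
    obtain x y where xy: "A = {x, y}" "x \<noteq> y" using c by (auto simp: card_2_iff)
    then have "B \<subseteq> cn x y" using ad by (auto simp: nb_iff)
    also have "cn x y = {a, b}" using cn_N[of x y] xy A by blast
    finally have "B \<subseteq> {a, b}" .
    then have "B = {a, b}" using c ab by (intro card_subset_eq) auto
    then show ?thesis using A c by blast
  qed
  have "C4s (V, E) \<subseteq> (\<lambda>P. C4_of P {a, b}) ` ?P"
  proof
    fix C assume "C \<in> C4s (V, E)"
    then obtain A B where C: "C = C4_of A B" and c: "card A = 2" "card B = 2"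
      and ad: "\<forall>a\<in>A. \<forall>b\<in>B. adj a b" unfolding C4s_eq by blast
    have ad': "\<forall>a\<in>B. \<forall>b\<in>A. adj a b" using ad adj_sym by blast
    have "A \<subseteq> N \<or> B \<subseteq> N"
    proof (rule ccontr)
      assume nn: "\<not> ?thesis"
      obtain p q where A: "A = {p, q}" "p \<noteq> q" using c by (auto simp: card_2_iff)
      obtain p' q' where B: "B = {p', q'}" "p' \<noteq> q'" using c by (auto simp: card_2_iff)
      have "{p, q, p', q'} \<subseteq> N \<union> {a, b}" using ad A B adj_V V by blast
      moreover have "adj p p'" "adj p q'" "adj q p'" "adj q q'" using ad A B by auto
      moreover have "\<not> {p, q} \<subseteq> N" "\<not> {p', q'} \<subseteq> N" using nn A B by auto
      moreover have "p \<noteq> p'" "p \<noteq> q'" "q \<noteq> p'" "q \<noteq> q'" using ad A B by auto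
      ultimately have "adj a b \<and> (\<exists>x\<in>N. \<exists>y\<in>N. adj x y)"
        using A(2) B(2) adj_sym by (auto simp del: ab_notin_N)
      with no show False ..
    qed
    then show "C \<in> (\<lambda>P. C4_of P {a, b}) ` ?P"
      using main[OF _ c ad] main[OF _ c(2,1) ad'] unfolding C C4_of_commute[of B A] by blast
  qed
  moreover have "finite ?P" by (rule finite_subset[of _ "Pow N"]) auto
  ultimately have "card (C4s (V, E)) \<le> card ?P" by (intro surj_card_le)
  also have "card ?P = Suc s choose 2" using n_subsets[OF finite_N, of 2] card_N by simp
  finally show ?thesis .
qed

text \<open>With \<open>R\<close> empty, \<open>N\<close> is all of \<open>V - {a, b}\<close>, so
  every edge between the parts is present, and \<open>N_edges\<close> leaves \<open>{x, y}\<close>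
  as the only edge inside \<open>N\<close>.\<close>

lemma span_extremal:
  assumes R: "R = {}" and "adj a b" and xy: "x \<in> N" "y \<in> N" "adj x y"
  shows "K2_plus_edges (V, E) a b x y"
proof -
  have V: "N = V - {a, b}" using R N_V by (auto simp: R_def)
  have ne: "x \<noteq> y" using xy by auto
  have "E = {{a, b}, {x, y}} \<union> {{c, z} | c z. c \<in> {a, b} \<and> z \<in> V - {a, b}}" (is "_ = ?E")
  proof
    show "?E \<subseteq> E" using xy \<open>adj a b\<close> by (auto simp: V[symmetric] N_iff adj_def)
    show "E \<subseteq> ?E"
    proof
      fix e assume e: "e \<in> E"
      then obtain u w where uw: "e = {u, w}" "u \<noteq> w" using edge[OF e] by (auto simp: card_2_iff)
      then have ad: "adj u w" and "u \<in> N \<union> {a, b}" "w \<in> N \<union> {a, b}"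
        using e edge[OF e] by (auto simp: adj_def V)
      moreover have "e = {x, y}" if "u \<in> N" "w \<in> N"
        using N_edges[OF that xy(1,2) ad xy(3)] uw by simp
      ultimately show "e \<in> ?E" using uw unfolding V[symmetric] by (auto simp: insert_commute)
    qed
  qed
  moreover have "{x, y} \<subseteq> V - {a, b}" "{a, b} \<subseteq> V" using xy(1,2) ab_in_V unfolding V by auto
  ultimately show ?thesis using ab ne unfolding K2_plus_edges_def fst_conv snd_conv by blast
qed

end

text \<open>In the third alternative, deleting \<open>S\<close> raises the excess over the target by
  at least \<open>card S\<close>, which drives the induction in
  \<open>C6_free_graph_C4_bound\<close>. The pair \<open>a\<close>, \<open>b\<close> is chosen with
  the greatest codegree, and the cases follow the size of \<open>R\<close>.\<close>

lemma (in C6_free_graph) local_structure: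
  assumes n: "card V > 250"
  shows "card (C4s (V, E)) \<le> (card V - 2) choose 2 \<or> (\<exists>a b x y. K2_plus_edges (V, E) a b x y) \<or>
    (\<exists>S\<subseteq>V. S \<noteq> {} \<and> card {C \<in> C4s (V, E). verts C \<inter> S \<noteq> {}} + card S + ((card V - card S - 2) choose 2)
       \<le> (card V - 2) choose 2)"
proof (cases "\<forall>u w. u \<noteq> w \<longrightarrow> card (cn u w) \<le> 7")
  case True
  then have "card (C4s (V, E)) < (card V - 2) choose 2" using n by (intro small_codegree) auto
  then show ?thesis by simp
next
  case False
  let ?Q = "\<lambda>k. \<exists>u w. u \<noteq> w \<and> card (cn u w) = k"
  from False obtain u0 w0 where uw0: "u0 \<noteq> w0" "card (cn u0 w0) > 7" by (auto simp: not_le)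
  then have k0: "?Q (card (cn u0 w0))" by blast
  have bound: "k \<le> card V" if "?Q k" for k
  proof -
    from that obtain u w where "k = card (cn u w)" by blast
    then show ?thesis using nb_V[of u] finite_V by (auto intro!: card_mono)
  qed
  define m where "m = (GREATEST k. ?Q k)"
  have "?Q m" unfolding m_def by (rule GreatestI_nat[of ?Q, OF k0 bound])
  then obtain a b where ab: "a \<noteq> b" "card (cn a b) = m" by blast
  have max: "card (cn u w) \<le> m" if "u \<noteq> w" for u w
    unfolding m_def by (rule Greatest_le_nat[of ?Q, OF _ bound]) (use that in blast)
  have "m > 7" using max[OF uw0(1)] uw0(2) by linarith
  then interpret fat_pair V E a b "m - 1"
    using ab max by unfold_locales auto
  have m: "Suc (m - 1) = m" using \<open>m > 7\<close> by simp
  consider "7 \<le> card R" | y where "y \<in> R" "card R \<le> 6" | "R = {}" by fastforce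
  then show ?thesis
  proof cases
    case 1
    have "N \<subseteq> V" "N \<noteq> {}" using N_V card_cn by (auto simp: N_def)
    then show ?thesis using remove_N[OF n 1] by blast
  next
    case 2
    have "{y} \<subseteq> V" "{y} \<noteq> {}" using 2 by (auto simp: R_def)
    then show ?thesis using remove_vertex[OF n 2(2,1)] by (intro disjI2 exI[of _ "{y}"]) simp
  next
    case 3
    have "card V - 2 = Suc (m - 1)" using card_V 3 by simp
    show ?thesis
    proof (cases "adj a b \<and> (\<exists>x\<in>N. \<exists>y\<in>N. adj x y)")
      case True
      then show ?thesis using span_extremal[OF 3] by blast
    next
      case False
      then show ?thesis using C4s_span[OF 3] \<open>card V - 2 = _\<close> by simp
    qed
  qed
qed

lemma C6_free_graph_iff:
  "C6_free_graph (verts G) (edges G) \<longleftrightarrow> simple_graph G \<and> free_of (cycle_graph 6) G"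
proof
  assume G: "C6_free_graph (verts G) (edges G)"
  then have s: "simple_graph G" by (simp add: C6_free_graph_def simple_graph_def)
  moreover have "free_of (cycle_graph 6) G"
    unfolding free_of_C6[OF s] using C6_free_graph.no_C6[OF G] by blast
  ultimately show "simple_graph G \<and> free_of (cycle_graph 6) G" ..
next
  assume G: "simple_graph G \<and> free_of (cycle_graph 6) G"
  then have s: "simple_graph G" ..
  show "C6_free_graph (verts G) (edges G)"
  proof
    fix a b c d e f
    assume "{a, b} \<in> edges G" "{b, c} \<in> edges G" "{c, d} \<in> edges G" "{d, e} \<in> edges G"
      "{e, f} \<in> edges G" "{f, a} \<in> edges G"
    then show "\<not> distinct [a, b, c, d, e, f]"
      using G unfolding free_of_C6[OF s] by blast
  qed (use s in \<open>auto simp: simple_graph_def\<close>)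
qed

section \<open>The extremal graph\<close>

text \<open>Six vertices give \<open>a\<close> and \<open>b\<close> at least four common neighbours,
  so that \<open>cn_of_fat\<close> applies to them.\<close>

locale K2_plus =
  fixes V :: "'a set" and E :: "'a set set" and a b x y :: 'a
  assumes fin: "finite V" and K2: "K2_plus_edges (V, E) a b x y" and card_V: "card V \<ge> 6"
begin

lemma ne: "a \<noteq> b" "x \<noteq> y" and mem: "a \<in> V" "b \<in> V" "x \<in> V - {a, b}" "y \<in> V - {a, b}"
  using K2 by (auto simp: K2_plus_edges_def)

lemma E_eq: "E = {{a, b}, {x, y}} \<union> {{c, z} | c z. c \<in> {a, b} \<and> z \<in> V - {a, b}}"
  using K2 by (simp add: K2_plus_edges_def)

lemma E_meets: "e \<in> E \<Longrightarrow> e \<inter> {a, b} \<noteq> {} \<or> e = {x, y}"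
  unfolding E_eq by blast

text \<open>Every edge other than \<open>{x, y}\<close> meets \<open>{a, b}\<close>, which three
  disjoint edges cannot all do.\<close>

lemma matching:
  assumes "{p, q} \<in> E" "{r, s} \<in> E" "{t, u} \<in> E" "distinct [p, q, r, s, t, u]"
  shows "{p, q} = {x, y} \<or> {r, s} = {x, y} \<or> {t, u} = {x, y}"
proof (rule ccontr)
  assume no: "\<not> ?thesis"
  have "{p, q} \<inter> {a, b} \<noteq> {}" "{r, s} \<inter> {a, b} \<noteq> {}" "{t, u} \<inter> {a, b} \<noteq> {}"
    using E_meets[OF assms(1)] E_meets[OF assms(2)] E_meets[OF assms(3)] no by blast+
  then obtain i j k where ijk: "i \<in> {p, q}" "j \<in> {r, s}" "k \<in> {t, u}"
      "i \<in> {a, b}" "j \<in> {a, b}" "k \<in> {a, b}" by blast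
  have "i \<noteq> j" "j \<noteq> k" "i \<noteq> k" using ijk(1-3) assms(4) by auto
  then show False using ijk(4-6) by blast
qed

text \<open>A hexagon splits into two perfect matchings. By \<open>matching\<close> both contain
  \<open>{x, y}\<close>, but they share no edge.\<close>

lemma no_C6_span:
  assumes "{p, q} \<in> E" "{q, r} \<in> E" "{r, s} \<in> E" "{s, t} \<in> E" "{t, u} \<in> E" "{u, p} \<in> E"
  shows "\<not> distinct [p, q, r, s, t, u]"
proof
  assume d: "distinct [p, q, r, s, t, u]"
  have 1: "{p, q} = {x, y} \<or> {r, s} = {x, y} \<or> {t, u} = {x, y}"
    using matching[OF assms(1,3,5)] d by simp
  have "distinct [q, r, s, t, u, p]" using d by auto
  then have 2: "{q, r} = {x, y} \<or> {s, t} = {x, y} \<or> {u, p} = {x, y}"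
    using matching[OF assms(2,4,6)] by blast
  have "{p, q} \<noteq> {q, r}" "{p, q} \<noteq> {s, t}" "{p, q} \<noteq> {u, p}"
    "{r, s} \<noteq> {q, r}" "{r, s} \<noteq> {s, t}" "{r, s} \<noteq> {u, p}"
    "{t, u} \<noteq> {q, r}" "{t, u} \<noteq> {s, t}" "{t, u} \<noteq> {u, p}"
    using d by (simp_all add: doubleton_eq_iff) fast+
  with 1 2 show False by (elim disjE) simp_all
qed

sublocale C6_free_graph V E
proof
  show "finite V" by (rule fin)
  show "X \<subseteq> V \<and> card X = 2" if "X \<in> E" for X
  proof -
    from that consider "X = {a, b}" | "X = {x, y}" | c z where "X = {c, z}" "c \<in> {a, b}" "z \<in> V - {a, b}"
      unfolding E_eq by blast
    then show ?thesis using mem ne by cases auto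
  qed
qed (rule no_C6_span)

lemma adj_ab: "adj a b" "adj b a" and adj_xy: "adj x y" "adj y x"
proof -
  have "{a, b} \<in> E" "{x, y} \<in> E" by (subst E_eq; blast)+
  then show "adj a b" "adj b a" "adj x y" "adj y x" by (simp_all add: adj_def insert_commute)
qed

lemma adj_side: "c \<in> {a, b} \<Longrightarrow> z \<in> V - {a, b} \<Longrightarrow> adj c z \<and> adj z c"
proof -
  assume "c \<in> {a, b}" "z \<in> V - {a, b}"
  then have "{c, z} \<in> E" unfolding E_eq by blast
  then show ?thesis by (simp add: adj_def insert_commute)
qed

lemma adj_inside:
  assumes "p \<in> V - {a, b}" "q \<in> V - {a, b}" "adj p q" shows "{p, q} = {x, y}"
  using E_meets[of "{p, q}"] assms by (auto simp: adj_def)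

lemma cn_ab: "cn a b = V - {a, b}"
proof
  show "V - {a, b} \<subseteq> cn a b"
  proof
    fix z assume "z \<in> V - {a, b}"
    then have "adj a z" "adj b z" using adj_side by blast+
    then show "z \<in> cn a b" by (simp add: nb_iff)
  qed
  show "cn a b \<subseteq> V - {a, b}" using nb_V[of a] by (auto simp: nb_iff)
qed

lemma card_outside: "card (V - {a, b}) = card V - 2"
  using fin mem ne by (simp add: card_Diff_subset)

abbreviation "pairs \<equiv> {P. P \<subseteq> V - {a, b} \<and> card P = 2}"

text \<open>A diagonal that avoids \<open>a\<close> and \<open>b\<close> forces the other to be
  \<open>{a, b}\<close>. Otherwise the diagonals are \<open>{a, p}\<close> and \<open>{b, q}\<close>
  with \<open>p\<close> and \<open>q\<close> adjacent, hence \<open>{p, q} = {x, y}\<close>; this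
  yields the two extra 4-cycles.\<close>

lemma C4s_K2_plus:
  "C4s (V, E) = (\<lambda>P. C4_of P {a, b}) ` pairs \<union> {C4_of {a, x} {b, y}, C4_of {a, y} {b, x}}"
  (is "_ = ?A \<union> ?B")
proof
  have "?A \<subseteq> C4s (V, E)"
  proof (rule image_subsetI)
    fix P assume "P \<in> pairs"
    then have P: "P \<subseteq> V - {a, b}" "card P = 2" by blast+
    have "\<forall>u\<in>P. \<forall>w\<in>{a, b}. adj u w" using P adj_side by blast
    moreover have "card {a, b} = 2" using ne by simp
    ultimately show "C4_of P {a, b} \<in> C4s (V, E)" using P(2) unfolding C4s_eq by blast
  qed
  moreover have "C4_of {a, p} {b, q} \<in> C4s (V, E)"
    if "p \<in> V - {a, b}" "q \<in> V - {a, b}" "adj p q" for p q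
  proof -
    have "\<forall>u\<in>{a, p}. \<forall>w\<in>{b, q}. adj u w" using adj_side[of a] adj_side[of b] adj_ab that by simp
    moreover have "card {a, p} = 2" "card {b, q} = 2" using that by auto
    ultimately show ?thesis unfolding C4s_eq by blast
  qed
  ultimately show "?A \<union> ?B \<subseteq> C4s (V, E)" using mem(3,4) adj_xy by simp
  show "C4s (V, E) \<subseteq> ?A \<union> ?B"
  proof
    fix C assume "C \<in> C4s (V, E)"
    then obtain A B where C: "C = C4_of A B" and c: "card A = 2" "card B = 2"
      and ad: "\<forall>a\<in>A. \<forall>b\<in>B. adj a b" unfolding C4s_eq by blast
    have ad': "\<forall>a\<in>B. \<forall>b\<in>A. adj a b" using ad adj_sym by blast
    have inside: "C4_of A B \<in> ?A" if AV: "A \<subseteq> V - {a, b}"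
        and c: "card A = 2" "card B = 2" and ad: "\<forall>u\<in>A. \<forall>w\<in>B. adj u w" for A B
    proof -
      obtain p q where A: "A = {p, q}" "p \<noteq> q" using c(1) by (auto simp: card_2_iff)
      then have "B \<subseteq> cn p q" using ad by (auto simp: nb_iff)
      also have "cn p q = {a, b}"
        using A AV ne card_V by (intro cn_of_fat) (simp_all add: cn_ab card_outside)
      finally have "B = {a, b}" using c ne by (intro card_subset_eq) auto
      then show ?thesis using AV c by blast
    qed
    have cross: "C4_of A B \<in> ?B" if A: "a \<in> A" "b \<notin> A" and B: "b \<in> B" "a \<notin> B"
        and c: "card A = 2" "card B = 2" and ad: "\<forall>u\<in>A. \<forall>w\<in>B. adj u w" for A B
    proof -
      obtain p where Ap: "A = {a, p}" "p \<noteq> a" using A c(1) by (auto simp: card_2_iff doubleton_eq_iff)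
      obtain q where Bq: "B = {b, q}" "q \<noteq> b" using B c(2) by (auto simp: card_2_iff doubleton_eq_iff)
      have "adj p q" using ad Ap Bq by simp
      moreover have "p \<in> V - {a, b}" "q \<in> V - {a, b}"
        using adj_V[OF \<open>adj p q\<close>] A B Ap Bq by auto
      ultimately have "{p, q} = {x, y}" by (intro adj_inside)
      then show ?thesis unfolding Ap Bq by (auto simp: doubleton_eq_iff)
    qed
    have dis: "A \<inter> B = {}" using ad by (rule C4_of_disjoint)
    have "A \<subseteq> V" "B \<subseteq> V" using ad ad' adj_V c by (metis card.empty ex_in_conv subsetI zero_neq_numeral)+
    then consider "A \<subseteq> V - {a, b}" | "B \<subseteq> V - {a, b}"
      | "a \<in> A" "b \<notin> A" "b \<in> B" "a \<notin> B" | "a \<in> B" "b \<notin> B" "b \<in> A" "a \<notin> A"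
      using dis by blast
    then show "C \<in> ?A \<union> ?B"
    proof cases
      case 1 then show ?thesis using inside[OF _ c ad] C by blast
    next
      case 2 then show ?thesis using inside[OF _ c(2,1) ad'] C C4_of_commute[of A B] by simp
    next
      case 3 then show ?thesis using cross[OF _ _ _ _ c ad] C by blast
    next
      case 4
      then have "C4_of B A \<in> ?B" using cross[OF _ _ _ _ c(2,1) ad'] by blast
      then show ?thesis unfolding C C4_of_commute[of A B] by blast
    qed
  qed
qed

lemma card_C4s_K2_plus: "card (C4s (V, E)) = ((card V - 2) choose 2) + 2"
proof -
  have "inj_on (\<lambda>P. C4_of P {a, b}) pairs"
  proof (rule inj_onI)
    fix P Q assume P: "P \<in> pairs" and Q: "Q \<in> pairs" and "C4_of P {a, b} = C4_of Q {a, b}"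
    then have "P \<union> {a, b} = Q \<union> {a, b}" by (simp add: C4_of_def)
    then show "P = Q" using P Q by blast
  qed
  then have 1: "card ((\<lambda>P. C4_of P {a, b}) ` pairs) = (card V - 2) choose 2"
    using fin by (subst card_image) (auto simp: n_subsets card_outside)
  \<comment> \<open>The edge \<open>{a, b}\<close> separates the two extra 4-cycles from those with
    diagonal \<open>{a, b}\<close>; the edge \<open>{a, y}\<close> later tells the two
    apart.\<close>
  have ab: "{a, b} \<notin> edges (C4_of P {a, b})" if "P \<in> pairs" for P
    using that unfolding C4_of_def snd_conv by (auto simp: doubleton_eq_iff)
  have ab': "{a, b} \<in> edges (C4_of {a, p} {b, q})" for p q
    unfolding C4_of_def snd_conv by blast
  have 2: "(\<lambda>P. C4_of P {a, b}) ` pairs \<inter> {C4_of {a, x} {b, y}, C4_of {a, y} {b, x}} = {}"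
  proof (rule ccontr)
    assume "\<not> ?thesis"
    then obtain P where P: "P \<in> pairs"
        "C4_of P {a, b} = C4_of {a, x} {b, y} \<or> C4_of P {a, b} = C4_of {a, y} {b, x}" by blast
    then show False using ab[OF P(1)] ab'[of x y] ab'[of y x] by (elim disjE) simp_all
  qed
  have "{a, y} \<in> edges (C4_of {a, x} {b, y})" unfolding C4_of_def snd_conv by blast
  moreover have "{a, y} \<notin> edges (C4_of {a, y} {b, x})"
    using ne mem unfolding C4_of_pairs snd_conv by (auto simp: doubleton_eq_iff)
  ultimately have 3: "C4_of {a, x} {b, y} \<noteq> C4_of {a, y} {b, x}" by metis
  have "finite pairs" by (rule finite_subset[of _ "Pow V"]) (use fin in auto)
  then have "card (C4s (V, E)) = card ((\<lambda>P. C4_of P {a, b}) ` pairs)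
      + card {C4_of {a, x} {b, y}, C4_of {a, y} {b, x}}"
    unfolding C4s_K2_plus by (intro card_Un_disjoint 2) auto
  then show ?thesis using 1 3 by simp
qed

end

section \<open>Deleting vertices\<close>

context C6_free_graph
begin

lemma delete_vertices:
  assumes "S \<subseteq> V"
  shows "C6_free_graph (V - S) {e \<in> E. e \<subseteq> V - S}"
    and "card (C4s (V, E)) \<le> card (C4s (V - S, {e \<in> E. e \<subseteq> V - S})) + card {C \<in> C4s (V, E). verts C \<inter> S \<noteq> {}}"
proof -
  let ?E = "{e \<in> E. e \<subseteq> V - S}"
  show G: "C6_free_graph (V - S) ?E"
    by unfold_locales (use finite_V edge no_C6 in auto)
  have "C4s (V, E) \<subseteq> C4s (V - S, ?E) \<union> {C \<in> C4s (V, E). verts C \<inter> S \<noteq> {}}"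
  proof
    fix C assume C4: "C \<in> C4s (V, E)"
    then obtain A B where C: "C = C4_of A B" and c: "card A = 2" "card B = 2"
      and ad: "\<forall>a\<in>A. \<forall>b\<in>B. {a, b} \<in> E" unfolding C4s_def by auto
    have "C \<in> C4s (V - S, ?E)" if "verts C \<inter> S = {}"
    proof -
      have "\<forall>a\<in>A. \<forall>b\<in>B. {a, b} \<in> ?E"
        using ad edge that unfolding C by (fastforce simp: C4_of_def)
      then show ?thesis using C c unfolding C4s_def by auto
    qed
    then show "C \<in> C4s (V - S, ?E) \<union> {C \<in> C4s (V, E). verts C \<inter> S \<noteq> {}}" using C4 by blast
  qed
  then have "card (C4s (V, E)) \<le> card (C4s (V - S, ?E) \<union> {C \<in> C4s (V, E). verts C \<inter> S \<noteq> {}})"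
    using finite_C4s C6_free_graph.finite_C4s[OF G] by (intro card_mono) auto
  then show "card (C4s (V, E)) \<le> card (C4s (V - S, ?E)) + card {C \<in> C4s (V, E). verts C \<inter> S \<noteq> {}}"
    using card_Un_le le_trans by blast
qed

end

text \<open>The constant 94395 is \<open>3 * (31 choose 4)\<close>; the last summand of the first bound is a truncated difference.\<close>

lemma C6_free_graph_C4_bound:
  assumes "C6_free_graph V E"
  shows "card (C4s (V, E)) \<le> ((card V - 2) choose 2) + 2 + (94395 - card V)"
    and "94395 < card V \<Longrightarrow> \<nexists>a b x y. K2_plus_edges (V, E) a b x y \<Longrightarrow>
      card (C4s (V, E)) < ((card V - 2) choose 2) + 2"
proof -
  have "card (C4s (V, E)) \<le> ((card V - 2) choose 2) + 2 + (94395 - card V) \<and>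
    (94395 < card V \<and> (\<nexists>a b x y. K2_plus_edges (V, E) a b x y) \<longrightarrow>
      card (C4s (V, E)) < ((card V - 2) choose 2) + 2)"
    using assms
  proof (induction "card V" arbitrary: V E rule: less_induct)
    case less
    interpret C6_free_graph V E by (rule less.prems)
    show ?case
    \<comment> \<open>Up to 250 vertices the crude bound \<open>3 * (250 choose 2) = 93375\<close>
      fits into the allowance \<open>94395 - card V\<close>, which is at least 94145.\<close>
    proof (cases "card V \<le> 250")
      case True
      have "card (C4s (V, E)) \<le> 3 * (card V choose 2)" by (rule C4_count_le)
      also have "\<dots> \<le> 3 * (250 choose 2)" using True by (intro mult_le_mono2 binomial_right_mono)
      also have "\<dots> = 93375" by (simp add: choose_two)
      finally show ?thesis using True by linarith
    next
      case False
      then have n: "card V > 250" by simp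
      consider "card (C4s (V, E)) \<le> (card V - 2) choose 2"
        | a b x y where "K2_plus_edges (V, E) a b x y"
        | S where "S \<subseteq> V" "S \<noteq> {}"
            "card {C \<in> C4s (V, E). verts C \<inter> S \<noteq> {}} + card S + ((card V - card S - 2) choose 2)
              \<le> (card V - 2) choose 2"
        using local_structure[OF n] by blast
      then show ?thesis
      proof cases
        case 1
        then show ?thesis by auto
      next
        case 2
        then have "card (C4s (V, E)) = ((card V - 2) choose 2) + 2"
          using finite_V n by (intro K2_plus.card_C4s_K2_plus) (auto simp: K2_plus_def)
        then show ?thesis using 2 by auto
      next
        case 3
        let ?V = "V - S" and ?E = "{e \<in> E. e \<subseteq> V - S}"
        have S: "card ?V = card V - card S" "0 < card S" "card S \<le> card V"
          using 3(1,2) finite_V finite_subset[OF 3(1)]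
          by (auto simp: card_Diff_subset card_gt_0_iff card_mono)
        \<comment> \<open>Passing to \<open>?V\<close> enlarges the truncated difference by at most
          \<open>card S\<close>, which the condition on \<open>S\<close> pays back. If
          \<open>94395 < card V\<close>, it grows by strictly less than \<open>card S\<close>,
          whence the strict bound.\<close>
        have "card (C4s (?V, ?E)) \<le> ((card ?V - 2) choose 2) + 2 + (94395 - card ?V)"
          using less.hyps[OF _ delete_vertices(1)[OF 3(1)]] S by simp
        then show ?thesis using delete_vertices(2)[OF 3(1)] 3(3) S by (auto simp only: S(1))
      qed
    qed
  qed
  then show "card (C4s (V, E)) \<le> ((card V - 2) choose 2) + 2 + (94395 - card V)"
    and "94395 < card V \<Longrightarrow> \<nexists>a b x y. K2_plus_edges (V, E) a b x y \<Longrightarrow>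
      card (C4s (V, E)) < ((card V - 2) choose 2) + 2"
    by blast+
qed

section \<open>Isomorphism with the extremal graph\<close>

text \<open>As an image of a product, the set of edges between the parts can be carried along a
  vertex map with \<open>map_prod\<close>.\<close>

lemma pairs_image: "{{c, z} | c z. c \<in> C \<and> z \<in> Z} = (\<lambda>p. {fst p, snd p}) ` (C \<times> Z)"
proof (intro equalityI subsetI)
  fix e assume "e \<in> {{c, z} | c z. c \<in> C \<and> z \<in> Z}"
  then obtain c z where "e = {c, z}" "(c, z) \<in> C \<times> Z" by blast
  then show "e \<in> (\<lambda>p. {fst p, snd p}) ` (C \<times> Z)" by (intro image_eqI[of _ _ "(c, z)"]) simp_all
next
  fix e assume "e \<in> (\<lambda>p. {fst p, snd p}) ` (C \<times> Z)"
  then obtain c z where "e = {c, z}" "c \<in> C" "z \<in> Z" by (elim imageE SigmaE) simp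
  then show "e \<in> {{c, z} | c z. c \<in> C \<and> z \<in> Z}" by blast
qed

lemma image_K2_plus_edges:
  assumes f: "inj_on f V" and "a \<in> V" "b \<in> V"
  shows "(\<lambda>e. f ` e) ` ({{a, b}, {x, y}} \<union> {{c, z} | c z. c \<in> {a, b} \<and> z \<in> V - {a, b}}) =
    {{f a, f b}, {f x, f y}} \<union> {{c, z} | c z. c \<in> {f a, f b} \<and> z \<in> f ` V - {f a, f b}}"
proof -
  let ?p = "\<lambda>p. {fst p, snd p}"
  have "f ` (V - {a, b}) = f ` V - {f a, f b}"
    using inj_on_image_set_diff[OF f, of V "{a, b}"] assms by auto
  then have "{f a, f b} \<times> (f ` V - {f a, f b}) = map_prod f f ` ({a, b} \<times> (V - {a, b}))"
    using map_prod_surj_on[of f "{a, b}" "{f a, f b}" f "V - {a, b}"] by simp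
  then have "?p ` ({f a, f b} \<times> (f ` V - {f a, f b})) = (\<lambda>e. f ` e) ` ?p ` ({a, b} \<times> (V - {a, b}))"
    by (simp only: image_image fst_map_prod snd_map_prod image_insert image_empty)
  then show ?thesis unfolding pairs_image by (simp add: image_Un)
qed

lemma K2_plus_edges_image:
  assumes "bij_betw f (verts G) (verts H)" "(\<lambda>e. f ` e) ` edges G = edges H"
    and K: "K2_plus_edges G a b x y"
  shows "K2_plus_edges H (f a) (f b) (f x) (f y)"
proof -
  have f: "inj_on f (verts G)" "verts H = f ` verts G" using assms(1) by (auto simp: bij_betw_def)
  have m: "a \<noteq> b" "x \<noteq> y" "a \<in> verts G" "b \<in> verts G" "x \<in> verts G - {a, b}" "y \<in> verts G - {a, b}"
    and e: "edges G = {{a, b}, {x, y}} \<union> {{c, z} | c z. c \<in> {a, b} \<and> z \<in> verts G - {a, b}}"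
    using K unfolding K2_plus_edges_def by blast+
  have "edges H = {{f a, f b}, {f x, f y}} \<union> {{c, z} | c z. c \<in> {f a, f b} \<and> z \<in> verts H - {f a, f b}}"
    unfolding assms(2)[symmetric] e f(2) by (rule image_K2_plus_edges[OF f(1) m(3,4)])
  moreover have "f a \<noteq> f b" "f x \<noteq> f y" "{f x, f y} \<subseteq> verts H - {f a, f b}" "{f a, f b} \<subseteq> verts H"
    using m inj_on_eq_iff[OF f(1)] by (auto simp: f(2))
  ultimately show ?thesis unfolding K2_plus_edges_def by (intro conjI)
qed

text \<open>Match the four named vertices and extend by any bijection of the rest; the names and the
  vertex set determine the edges.\<close>

lemma K2_plus_edges_isomorphic:
  assumes fin: "finite (verts G)" "finite (verts H)" and c: "card (verts G) = card (verts H)"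
    and G: "K2_plus_edges G a b x y" and H: "K2_plus_edges H a' b' x' y'"
  shows "isomorphic G H"
proof -
  let ?K = "{a, b, x, y}" and ?K' = "{a', b', x', y'}"
  have m: "a \<noteq> b" "x \<noteq> y" "a \<in> verts G" "b \<in> verts G" "x \<in> verts G - {a, b}" "y \<in> verts G - {a, b}"
    and e: "edges G = {{a, b}, {x, y}} \<union> {{c, z} | c z. c \<in> {a, b} \<and> z \<in> verts G - {a, b}}"
    using G unfolding K2_plus_edges_def by blast+
  have m': "a' \<noteq> b'" "x' \<noteq> y'" "a' \<in> verts H" "b' \<in> verts H" "x' \<in> verts H - {a', b'}" "y' \<in> verts H - {a', b'}"
    and e': "edges H = {{a', b'}, {x', y'}} \<union> {{c, z} | c z. c \<in> {a', b'} \<and> z \<in> verts H - {a', b'}}"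
    using H unfolding K2_plus_edges_def by blast+
  have K: "?K \<subseteq> verts G" "card ?K = 4" and K': "?K' \<subseteq> verts H" "card ?K' = 4"
    using m m' by auto
  have "card (verts G - ?K) = card (verts H - ?K')"
    using K K' c by (simp add: card_Diff_subset)
  then obtain h where h: "bij_betw h (verts G - ?K) (verts H - ?K')"
    using finite_same_card_bij[of "verts G - ?K" "verts H - ?K'"] fin by auto
  define f where "f v = (if v = a then a' else if v = b then b' else if v = x then x' else if v = y then y' else h v)" for v
  have fv: "f a = a'" "f b = b'" "f x = x'" "f y = y'" using m by (auto simp: f_def)
  have "bij_betw f (verts G - ?K) (verts H - ?K')"
    using h by (rule bij_betw_cong[THEN iffD1, rotated]) (auto simp: f_def)
  moreover have "bij_betw f ?K ?K'"
    unfolding bij_betw_def using fv m' by (auto simp: inj_on_def)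
  ultimately have "bij_betw f ((verts G - ?K) \<union> ?K) ((verts H - ?K') \<union> ?K')"
    by (intro bij_betw_combine) auto
  then have f: "bij_betw f (verts G) (verts H)"
    using K(1) K'(1) by (simp add: Un_absorb2 Un_commute del: Un_insert_left Un_insert_right)
  then have "inj_on f (verts G)" "f ` verts G = verts H" by (auto simp: bij_betw_def)
  then have "(\<lambda>e. f ` e) ` edges G = edges H"
    unfolding e e' using image_K2_plus_edges[of f "verts G" a b x y] m fv by simp
  with f show ?thesis unfolding isomorphic_def by blast
qed

text \<open>Simplicity puts each edge inside the vertex set, where the inverse bijection undoes
  \<open>f\<close>.\<close>

lemma isomorphic_sym:
  assumes "simple_graph G" "isomorphic G H"
  shows "isomorphic H G"
proof -
  obtain f where f: "bij_betw f (verts G) (verts H)" and e: "(\<lambda>e. f ` e) ` edges G = edges H"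
    using assms(2) unfolding isomorphic_def by blast
  define g where "g = inv_into (verts G) f"
  have "g ` f ` e = e" if "e \<in> edges G" for e
    using f assms(1) that unfolding g_def
    by (intro inv_into_image_cancel) (auto simp: bij_betw_def simple_graph_def)
  then have "(\<lambda>e. g ` e) ` edges H = edges G"
    unfolding e[symmetric] image_image by simp
  moreover have "bij_betw g (verts H) (verts G)" unfolding g_def using f by (rule bij_betw_inv_into)
  ultimately show ?thesis unfolding isomorphic_def by blast
qed

lemma extremal_graph_K2_plus_edges:
  assumes "4 \<le> n"
  shows "K2_plus_edges (extremal_graph n) (Inl 0) (Inl 1) (Inr 0) (Inr 1)"
    and "finite (verts (extremal_graph n))" and "card (verts (extremal_graph n)) = n"
proof -
  let ?V = "Inl ` {..<2} \<union> Inr ` {..<n - 2} :: (nat + nat) set"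
  have v: "verts (extremal_graph n) = ?V"
    by (simp add: extremal_graph_def complete_bipartite_def)
  have two: "{..<2} = {0, 1::nat}" by auto
  show "finite (verts (extremal_graph n))" unfolding v by simp
  have "card ?V = card (Inl ` {..<2} :: (nat + nat) set) + card (Inr ` {..<n - 2} :: (nat + nat) set)"
    by (intro card_Un_disjoint) auto
  then show "card (verts (extremal_graph n)) = n"
    using assms unfolding v by (simp add: card_image)
  have d: "?V - {Inl 0, Inl 1} = Inr ` {..<n - 2}" unfolding two by auto
  have edges: "({{Inl i, Inr j} | i j. i < 2 \<and> j < n - 2} :: (nat + nat) set set) =
      {{c, z} | c z. c \<in> {Inl 0, Inl 1} \<and> z \<in> Inr ` {..<n - 2}}"
  proof (intro equalityI subsetI)
    fix e :: "(nat + nat) set" assume "e \<in> {{Inl i, Inr j} | i j. i < 2 \<and> j < n - 2}"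
    then obtain i j where e: "e = {Inl i, Inr j}" "i < 2" "j < n - 2" by blast
    then have "(Inl i :: nat + nat) \<in> {Inl 0, Inl 1}" by auto
    with e show "e \<in> {{c, z} | c z. c \<in> {Inl 0, Inl 1} \<and> z \<in> Inr ` {..<n - 2}}" by blast
  next
    fix e :: "(nat + nat) set"
    assume "e \<in> {{c, z} | c z. c \<in> {Inl 0, Inl 1} \<and> z \<in> Inr ` {..<n - 2}}"
    then obtain c j where e: "e = {c, Inr j}" "c = Inl 0 \<or> c = Inl 1" "j < n - 2" by auto
    then obtain i where "c = Inl i" "i < 2" by auto
    with e show "e \<in> {{Inl i, Inr j} | i j. i < 2 \<and> j < n - 2}" by blast
  qed
  have "edges (extremal_graph n) = {{Inl 0, Inl 1}, {Inr 0, Inr 1}} \<union>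
      {{c, z} | c z. c \<in> {Inl 0, Inl 1} \<and> z \<in> Inr ` {..<n - 2}}"
    unfolding extremal_graph_def complete_bipartite_def snd_conv edges by (rule Un_commute)
  moreover have "{Inr 0, Inr 1} \<subseteq> (Inr ` {..<n - 2} :: (nat + nat) set)" using assms by auto
  moreover have "{Inl 0, Inl 1} \<subseteq> ?V" unfolding two by simp
  ultimately show "K2_plus_edges (extremal_graph n) (Inl 0) (Inl 1) (Inr 0) (Inr 1)"
    unfolding K2_plus_edges_def v d by simp
qed

lemma isomorphic_extremal_graph_iff:
  assumes G: "simple_graph G" "card (verts G) = n" and n: "4 \<le> n"
  shows "isomorphic G (extremal_graph n) \<longleftrightarrow> (\<exists>a b x y. K2_plus_edges G a b x y)"
proof
  assume "isomorphic G (extremal_graph n)"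
  then have "isomorphic (extremal_graph n) G" using G(1) by (rule isomorphic_sym[rotated])
  then obtain f where "bij_betw f (verts (extremal_graph n)) (verts G)"
      "(\<lambda>e. f ` e) ` edges (extremal_graph n) = edges G" unfolding isomorphic_def by blast
  from K2_plus_edges_image[OF this extremal_graph_K2_plus_edges(1)[OF n]]
  show "\<exists>a b x y. K2_plus_edges G a b x y" by blast
next
  assume "\<exists>a b x y. K2_plus_edges G a b x y"
  then obtain a b x y where K: "K2_plus_edges G a b x y" by blast
  show "isomorphic G (extremal_graph n)"
    by (rule K2_plus_edges_isomorphic[OF _ _ _ K extremal_graph_K2_plus_edges(1)[OF n]])
      (use G extremal_graph_K2_plus_edges(2,3)[OF n] in \<open>auto simp: simple_graph_def\<close>)
qed

section \<open>The extremal number and the extremal graphs\<close>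

lemma copies_K2_plus:
  assumes "finite (verts G)" "card (verts G) = n" "6 \<le> n" "K2_plus_edges G a b x y"
  shows "simple_graph G" and "free_of (cycle_graph 6) G" and "card (copies (cycle_graph 4) G) = ((n - 2) choose 2) + 2"
proof -
  interpret K2_plus "verts G" "edges G" a b x y
    unfolding K2_plus_def using assms by simp
  have G: "simple_graph G \<and> free_of (cycle_graph 6) G"
    using C6_free_graph_axioms by (simp only: C6_free_graph_iff)
  then show s: "simple_graph G" and "free_of (cycle_graph 6) G" by (rule conjunct1, rule conjunct2)
  show "card (copies (cycle_graph 4) G) = ((n - 2) choose 2) + 2"
    using card_C4s_K2_plus assms(2) by (simp add: copies_C4[OF s])
qed

lemma copies_C6_free:
  assumes "simple_graph G" "free_of (cycle_graph 6) G" "card (verts G) = n" "94395 < n"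
  shows "card (copies (cycle_graph 4) G) \<le> ((n - 2) choose 2) + 2"
    and "card (copies (cycle_graph 4) G) = ((n - 2) choose 2) + 2 \<Longrightarrow> \<exists>a b x y. K2_plus_edges G a b x y"
proof -
  have G: "C6_free_graph (verts G) (edges G)" using assms C6_free_graph_iff by blast
  show "card (copies (cycle_graph 4) G) \<le> ((n - 2) choose 2) + 2"
    using C6_free_graph_C4_bound(1)[OF G] assms by (simp add: copies_C4)
  show "\<exists>a b x y. K2_plus_edges G a b x y"
    if "card (copies (cycle_graph 4) G) = ((n - 2) choose 2) + 2"
    using C6_free_graph_C4_bound(2)[OF G] assms that by (force simp: copies_C4)
qed

theorem theorem3:
  fixes n :: nat
  assumes "n > 3 * (31 choose 4)"
  shows "ex_num n (cycle_graph 4) (cycle_graph 6) = ((n - 2) choose 2) + 2 \<and>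
    (\<forall>G :: 'a sgraph. simple_graph G \<and> card (verts G) = n \<longrightarrow>
       (free_of (cycle_graph 6) G \<and>
          card (copies (cycle_graph 4) G) = ex_num n (cycle_graph 4) (cycle_graph 6)
        \<longleftrightarrow> isomorphic G (extremal_graph n)))"
proof -
  \<comment> \<open>The value of \<open>31 choose 4\<close> is reached from
    \<open>29 choose 2\<close> by the absorption identity
    \<open>k * (n choose k) = n * ((n - 1) choose (k - 1))\<close>.\<close>
  have "29 choose 2 = (406 :: nat)" by (simp add: choose_two)
  moreover have "3 * (30 choose 3) = 30 * (29 choose 2 :: nat)"
    using Suc_times_binomial[of 2 29] by simp
  moreover have "4 * (31 choose 4) = 31 * (30 choose 3 :: nat)"
    using Suc_times_binomial[of 3 30] by simp
  ultimately have n: "94395 < n" using assms by simp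
  have "ex_num n (cycle_graph 4) (cycle_graph 6) = ((n - 2) choose 2) + 2"
    unfolding ex_num_def
  proof (rule Max_eqI)
    let ?M = "{card (copies (cycle_graph 4) G) | G :: nat sgraph.
            simple_graph G \<and> verts G = {..<n} \<and> free_of (cycle_graph 6) G}"
    show le: "k \<le> ((n - 2) choose 2) + 2" if "k \<in> ?M" for k
    proof -
      from that obtain G :: "nat sgraph" where "k = card (copies (cycle_graph 4) G)"
        "simple_graph G" "verts G = {..<n}" "free_of (cycle_graph 6) G" by blast
      then show ?thesis using copies_C6_free(1)[of G n] n by simp
    qed
    then show "finite ?M" unfolding finite_nat_set_iff_bounded_le by blast
    \<comment> \<open>The maximum is attained by the extremal graph written on
      \<open>{..<n}\<close>, with small part \<open>{0, 1}\<close> and the other inner edge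
      \<open>{2, 3}\<close>.\<close>
    let ?G = "({..<n}, {{0, 1}, {2, 3}} \<union> {{c, z} | c z. c \<in> {0, 1} \<and> z \<in> {..<n} - {0, 1}}) :: nat sgraph"
    have K: "K2_plus_edges ?G 0 1 2 3"
      unfolding K2_plus_edges_def fst_conv snd_conv using n by (intro conjI refl) auto
    have G: "finite (verts ?G)" "card (verts ?G) = n" "6 \<le> n" using n by simp_all
    show "((n - 2) choose 2) + 2 \<in> ?M"
      using copies_K2_plus[OF G K] by (intro CollectI exI[of _ ?G]) simp
  qed
  moreover have "free_of (cycle_graph 6) G \<and> card (copies (cycle_graph 4) G) = ((n - 2) choose 2) + 2
      \<longleftrightarrow> isomorphic G (extremal_graph n)"
    if G: "simple_graph G" "card (verts G) = n" for G :: "'a sgraph"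
  proof -
    have "isomorphic G (extremal_graph n) \<longleftrightarrow> (\<exists>a b x y. K2_plus_edges G a b x y)"
      using G n by (intro isomorphic_extremal_graph_iff) auto
    moreover have "6 \<le> n" "finite (verts G)" using n G by (simp_all add: simple_graph_def)
    ultimately show ?thesis
      using copies_K2_plus[OF _ G(2)] copies_C6_free(2)[OF G(1) _ G(2) n] by blast
  qed
  ultimately show ?thesis by simp
qed

end
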